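(* Let $\mathfrak{g}$ be a Kac--Moody algebra, $\lambda\in P^+$, and let $V$ be a highest weight $\mathfrak{g}$-module with highest weight $\lambda$ and $J_V=\mathcal{I}$. Fix a weight $\mu\in\mathrm{wt}\,V$ with $\mathrm{supp}(\lambda-\mu)$ not independent. Then there exist a weight $\widehat\mu\in\mathrm{wt}\,V$ and a node $i\in\mathrm{supp}(\lambda-\mu)$ such that $$\langle\widehat\mu,\alpha_i^\vee\rangle>0,\qquad \widehat\mu\succ\mu\qquad\text{and}\qquad \mu\in[s_i\widehat\mu,\widehat\mu]\subseteq\mathrm{wt}\,V.$$ More generally, there exist a sequence of weights $$\mu_0=\mu\prec\mu_1\prec\cdots\prec\mu_n\ \text{ in }\mathrm{wt}\,V$$ and (not necessarily distinct) nodes $i_1,\dots,i_n\in\mathrm{supp}(\lambda-\mu)$ such that for all $1\leq t\leq n$ $$\langle\mu_t,\alpha_{i_t}^\vee\rangle\in\mathbb{Z}_{>0},\qquad \mu_{t-1}\in[s_{i_t}(\mu_t),\mu_t],$$ the set $\mathrm{supp}(\lambda-\mu_n)$ is independent, and $$\mu_n=\lambda-\sum_{i\in\mathrm{supp}(\lambda-\mu_n)}d_i\alpha_i\quad\text{with } d_i>\lambda(\alpha_i^\vee)\ \text{ for all }i\in\mathrm{supp}(\lambda-\mu_n).$$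
   Context: $\mathfrak{g}=\mathfrak{g}(A)$ is the complex Kac--Moody Lie algebra of a generalized Cartan matrix $A$ (not necessarily symmetrizable) with finite index set $\mathcal{I}$ (the nodes of the Dynkin diagram), Cartan subalgebra $\mathfrak{h}$, simple roots $\alpha_i$, simple co-roots $\alpha_i^\vee$ and simple reflections $s_i$ ($i\in\mathcal{I}$). $P^+$ is the set of dominant integral weights; $\langle\mu,\alpha_i^\vee\rangle=\mu(\alpha_i^\vee)$. A highest weight module is a nonzero quotient $V$ of the Verma module $M(\lambda)$; $\mathrm{wt}\,V$ is its set of weights. $x\preceq y$ means $y-x\in\mathbb{Z}_{\geq0}\{\alpha_i:i\in\mathcal{I}\}$, and $\prec$ is the strict version ($x\prec y$, equivalently $y\succ x$, means $x\preceq y$ and $x\neq y$). For $x=\sum_i x_i\alpha_i$, $\mathrm{supp}(x)=\{i:x_i\neq0\}$. For $k\in\mathbb{Z}_{\geq0}$, $[\mu-k\alpha,\mu]=\{\mu-j\alpha: 0\leq j\leq k\}$ ($j$ integer). A subset of $\mathcal{I}$ is independent if no two distinct nodes in it are joined by an edge of the Dynkin diagram ($\emptyset$ is independent). With $J_\lambda=\{i:\lambda(\alpha_i^\vee)\in\mathbb{Z}_{\geq0}\}$, $J_V\subseteq J_\lambda$ is the union of all independent $I\subseteq J_\lambda$ such that $\lambda-\sum_{i\in I}(\lambda(\alpha_i^\vee)+1)\alpha_i\notin\mathrm{wt}\,V$ and which are minimal under inclusion with this property. *)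

theory Defs
  imports "HOL-Analysis.Cartesian_Space" "HOL-Library.Poly_Mapping"
begin

section \<open>Complex Lie algebras\<close>

locale lie_algebra = vector_space sg
  for sg :: "complex \<Rightarrow> 'g::ab_group_add \<Rightarrow> 'g" +
  fixes br :: "'g \<Rightarrow> 'g \<Rightarrow> 'g"
  assumes br_linear_left: "\<And>y. Vector_Spaces.linear sg sg (\<lambda>x. br x y)"
    and br_linear_right: "\<And>x. Vector_Spaces.linear sg sg (br x)"
    and br_self: "\<And>x. br x x = 0"
    and jacobi: "\<And>x y z. br x (br y z) + br y (br z x) + br z (br x y) = 0"

definition lie_subalgebra ::
  "(complex \<Rightarrow> 'g::ab_group_add \<Rightarrow> 'g) \<Rightarrow> ('g \<Rightarrow> 'g \<Rightarrow> 'g) \<Rightarrow> 'g set \<Rightarrow> bool" where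
  "lie_subalgebra sg br S \<longleftrightarrow> module.subspace sg S \<and> (\<forall>x\<in>S. \<forall>y\<in>S. br x y \<in> S)"

definition lie_ideal ::
  "(complex \<Rightarrow> 'g::ab_group_add \<Rightarrow> 'g) \<Rightarrow> ('g \<Rightarrow> 'g \<Rightarrow> 'g) \<Rightarrow> 'g set \<Rightarrow> bool" where
  "lie_ideal sg br S \<longleftrightarrow> module.subspace sg S \<and> (\<forall>x. \<forall>y\<in>S. br x y \<in> S)"


section \<open>Kac--Moody algebras\<close>

definition gcm :: "int ^ 'i ^ 'i \<Rightarrow> bool" where
  "gcm A \<longleftrightarrow> (\<forall>i. A $ i $ i = 2) \<and> (\<forall>i j. i \<noteq> j \<longrightarrow> A $ i $ j \<le> 0) \<and>
     (\<forall>i j. A $ i $ j = 0 \<longrightarrow> A $ j $ i = 0)"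

definition dual_space :: "(complex \<Rightarrow> 'h::ab_group_add \<Rightarrow> 'h) \<Rightarrow> ('h \<Rightarrow> complex) set" where
  "dual_space sh = {\<mu>. Vector_Spaces.linear sh (*) \<mu>}"

text \<open>
  A realization in the sense of Kac: the Cartan subalgebra is (the type) \<open>'h\<close>, and weights are
  functions \<open>'h \<Rightarrow> complex\<close>.  The dimension formula is \<open>dim = 2 n - rank A\<close>; as the right-hand side
  is positive and \<open>dim\<close> is \<open>0\<close> on spaces without a finite basis, it forces finite dimension.
\<close>

locale realization = h: vector_space sh
  for A :: "int ^ 'i::finite ^ 'i" and sh :: "complex \<Rightarrow> 'h::ab_group_add \<Rightarrow> 'h" +
  fixes coroot :: "'i \<Rightarrow> 'h" and sroot :: "'i \<Rightarrow> 'h \<Rightarrow> complex"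
  assumes gcm: "gcm A"
    and root_dual: "\<And>i. sroot i \<in> dual_space sh"
    and coroot_indep: "\<And>c. (\<Sum>i\<in>UNIV. sh (c i) (coroot i)) = 0 \<Longrightarrow> \<forall>i. c i = 0"
    and root_indep: "\<And>c. (\<forall>x. (\<Sum>i\<in>UNIV. c i * sroot i x) = 0) \<Longrightarrow> \<forall>i. c i = 0"
    and pairing: "\<And>i j. sroot j (coroot i) = of_int (A $ i $ j)"
    and dim_cartan: "h.dim (UNIV :: 'h set) + rank (\<chi> i j. complex_of_int (A $ i $ j)) = 2 * CARD('i)"

text \<open>
  The Kac--Moody algebra \<open>g(A)\<close> of a realization.  It is the quotient of the Lie algebra presented
  by the generators \<open>e i\<close>, \<open>f i\<close>, \<open>'h\<close> and the relations \<open>cartan_comm\<close> to \<open>ef\<close> by the largest ideal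
  meeting the Cartan subalgebra trivially: \<open>generated\<close> says that it is a quotient of the presented
  algebra, \<open>cartan_inj\<close> and \<open>no_ideals\<close> that the kernel is this largest ideal.  The map \<open>\<iota>\<close> is the
  inclusion of the Cartan subalgebra.
\<close>

locale kac_moody_algebra = realization A sh coroot sroot + lie_algebra sg br
  for A :: "int ^ 'i::finite ^ 'i" and sh :: "complex \<Rightarrow> 'h::ab_group_add \<Rightarrow> 'h"
    and coroot :: "'i \<Rightarrow> 'h" and sroot :: "'i \<Rightarrow> 'h \<Rightarrow> complex"
    and sg :: "complex \<Rightarrow> 'g::ab_group_add \<Rightarrow> 'g" and br :: "'g \<Rightarrow> 'g \<Rightarrow> 'g" +
  fixes \<iota> :: "'h \<Rightarrow> 'g" and e f :: "'i \<Rightarrow> 'g"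
  assumes cartan_linear: "Vector_Spaces.linear sh sg \<iota>"
    and cartan_inj: "inj \<iota>"
    and cartan_comm: "\<And>x y. br (\<iota> x) (\<iota> y) = 0"
    and he: "\<And>x i. br (\<iota> x) (e i) = sg (sroot i x) (e i)"
    and hf: "\<And>x i. br (\<iota> x) (f i) = sg (- sroot i x) (f i)"
    and ef: "\<And>i j. br (e i) (f j) = (if i = j then \<iota> (coroot i) else 0)"
    and generated: "lie_subalgebra sg br hull (range \<iota> \<union> range e \<union> range f) = UNIV"
    and no_ideals: "\<And>J. lie_ideal sg br J \<Longrightarrow> J \<inter> range \<iota> = {0} \<Longrightarrow> J = {0}"


section \<open>The root lattice and the Dynkin diagram\<close>

definition root_comb :: "('i::finite \<Rightarrow> 'h \<Rightarrow> complex) \<Rightarrow> ('i \<Rightarrow> complex) \<Rightarrow> 'h \<Rightarrow> complex" where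
  "root_comb sroot c = (\<lambda>x. \<Sum>i\<in>UNIV. c i * sroot i x)"

text \<open>The support is only meaningful for elements of the span of the simple roots.\<close>

definition root_coeff :: "('i::finite \<Rightarrow> 'h \<Rightarrow> complex) \<Rightarrow> ('h \<Rightarrow> complex) \<Rightarrow> 'i \<Rightarrow> complex" where
  "root_coeff sroot x = (THE c. x = root_comb sroot c)"

definition supp :: "('i::finite \<Rightarrow> 'h \<Rightarrow> complex) \<Rightarrow> ('h \<Rightarrow> complex) \<Rightarrow> 'i set" where
  "supp sroot x = {i. root_coeff sroot x i \<noteq> 0}"

definition wt_le :: "('i::finite \<Rightarrow> 'h \<Rightarrow> complex) \<Rightarrow> ('h \<Rightarrow> complex) \<Rightarrow> ('h \<Rightarrow> complex) \<Rightarrow> bool" where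
  "wt_le sroot x y \<longleftrightarrow> (\<exists>k :: 'i \<Rightarrow> nat. y - x = root_comb sroot (\<lambda>i. of_nat (k i)))"

definition wt_less :: "('i::finite \<Rightarrow> 'h \<Rightarrow> complex) \<Rightarrow> ('h \<Rightarrow> complex) \<Rightarrow> ('h \<Rightarrow> complex) \<Rightarrow> bool" where
  "wt_less sroot x y \<longleftrightarrow> wt_le sroot x y \<and> x \<noteq> y"

definition simple_reflection ::
  "('i \<Rightarrow> 'h) \<Rightarrow> ('i \<Rightarrow> 'h \<Rightarrow> complex) \<Rightarrow> 'i \<Rightarrow> ('h \<Rightarrow> complex) \<Rightarrow> 'h \<Rightarrow> complex" where
  "simple_reflection coroot sroot i \<mu> = (\<lambda>x. \<mu> x - \<mu> (coroot i) * sroot i x)"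

text \<open>
  The interval \<open>[x, y]\<close> in direction \<open>\<alpha>\<close>: it is \<open>{y, y - \<alpha>, \<dots>, y - k \<alpha>}\<close> if \<open>x = y - k \<alpha>\<close> for a
  natural number \<open>k\<close>, and empty if \<open>x\<close> is not of this form.
\<close>

definition wt_interval ::
  "('h \<Rightarrow> complex) \<Rightarrow> ('h \<Rightarrow> complex) \<Rightarrow> ('h \<Rightarrow> complex) \<Rightarrow> ('h \<Rightarrow> complex) set" where
  "wt_interval \<alpha> x y =
     {(\<lambda>z. y z - of_nat j * \<alpha> z) | j k :: nat. j \<le> k \<and> x = (\<lambda>z. y z - of_nat k * \<alpha> z)}"

definition dominant_integral ::
  "(complex \<Rightarrow> 'h::ab_group_add \<Rightarrow> 'h) \<Rightarrow> ('i \<Rightarrow> 'h) \<Rightarrow> ('h \<Rightarrow> complex) set" where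
  "dominant_integral sh coroot = {lam. lam \<in> dual_space sh \<and> (\<forall>i. lam (coroot i) \<in> \<nat>)}"

definition dynkin_edge :: "int ^ 'i ^ 'i \<Rightarrow> 'i \<Rightarrow> 'i \<Rightarrow> bool" where
  "dynkin_edge A i j \<longleftrightarrow> i \<noteq> j \<and> A $ i $ j \<noteq> 0"

definition independent_nodes :: "int ^ 'i ^ 'i \<Rightarrow> 'i set \<Rightarrow> bool" where
  "independent_nodes A I \<longleftrightarrow> (\<forall>i\<in>I. \<forall>j\<in>I. \<not> dynkin_edge A i j)"


section \<open>Verma modules\<close>

text \<open>
  Words over \<open>'a\<close> form the free monoid, written additively so that \<^term>\<open>(*)\<close> on the finitely supported
  functions \<open>'a fword \<Rightarrow>\<^sub>0 complex\<close> is the convolution product: this is the free unital associative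
  complex algebra on the set \<open>'a\<close>.
\<close>

datatype 'a fword = FWord "'a list"

instantiation fword :: (type) monoid_add
begin

definition zero_fword :: "'a fword" where "zero_fword = FWord []"

fun plus_fword :: "'a fword \<Rightarrow> 'a fword \<Rightarrow> 'a fword" where
  "plus_fword (FWord xs) (FWord ys) = FWord (xs @ ys)"

instance
proof
  fix a b c :: "'a fword"
  show "a + b + c = a + (b + c)" by (cases a; cases b; cases c) simp
  show "0 + a = a" by (cases a) (simp add: zero_fword_def)
  show "a + 0 = a" by (cases a) (simp add: zero_fword_def)
qed

end

type_synonym 'a free_alg = "'a fword \<Rightarrow>\<^sub>0 complex"

definition letter :: "'a \<Rightarrow> 'a free_alg" where
  "letter x = Poly_Mapping.single (FWord [x]) 1"

definition scalar :: "complex \<Rightarrow> 'a free_alg" where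
  "scalar c = Poly_Mapping.single 0 c"

definition left_ideal :: "'r::ring_1 set \<Rightarrow> bool" where
  "left_ideal L \<longleftrightarrow> 0 \<in> L \<and> (\<forall>x\<in>L. \<forall>y\<in>L. x + y \<in> L) \<and> (\<forall>a. \<forall>x\<in>L. a * x \<in> L)"

definition two_sided_ideal :: "'r::ring_1 set \<Rightarrow> bool" where
  "two_sided_ideal L \<longleftrightarrow> left_ideal L \<and> (\<forall>a. \<forall>x\<in>L. x * a \<in> L)"

text \<open>The universal enveloping algebra is \<open>'g free_alg\<close> modulo this ideal.\<close>

definition enveloping_ideal ::
  "(complex \<Rightarrow> 'g::ab_group_add \<Rightarrow> 'g) \<Rightarrow> ('g \<Rightarrow> 'g \<Rightarrow> 'g) \<Rightarrow> 'g free_alg set" where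
  "enveloping_ideal sg br = two_sided_ideal hull
     ({letter (x + y) - letter x - letter y | x y. True} \<union>
      {letter (sg c x) - scalar c * letter x | c x. True} \<union>
      {letter x * letter y - letter y * letter x - letter (br x y) | x y. True})"

definition n_plus ::
  "(complex \<Rightarrow> 'g::ab_group_add \<Rightarrow> 'g) \<Rightarrow> ('g \<Rightarrow> 'g \<Rightarrow> 'g) \<Rightarrow> ('i \<Rightarrow> 'g) \<Rightarrow> 'g set" where
  "n_plus sg br e = lie_subalgebra sg br hull range e"

text \<open>
  The preimage in \<open>'g free_alg\<close> of the left ideal of the enveloping algebra generated by \<open>n\<^sup>+\<close> and
  all \<open>h - lam(h)\<close>, so that the Verma module is the quotient of \<open>'g free_alg\<close> by it.
\<close>

definition verma_ideal ::
  "(complex \<Rightarrow> 'g::ab_group_add \<Rightarrow> 'g) \<Rightarrow> ('g \<Rightarrow> 'g \<Rightarrow> 'g) \<Rightarrow> ('h \<Rightarrow> 'g) \<Rightarrow> ('i \<Rightarrow> 'g) \<Rightarrow>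
   ('h \<Rightarrow> complex) \<Rightarrow> 'g free_alg set" where
  "verma_ideal sg br \<iota> e lam = left_ideal hull
     (enveloping_ideal sg br \<union> letter ` n_plus sg br e \<union> {letter (\<iota> x) - scalar (lam x) | x. True})"

definition lcoset :: "'r::ring_1 set \<Rightarrow> 'r \<Rightarrow> 'r set" where
  "lcoset L a = {b. b - a \<in> L}"

definition quot_add :: "'r::ring_1 set \<Rightarrow> 'r set \<Rightarrow> 'r set \<Rightarrow> 'r set" where
  "quot_add L X Y = (\<Union>a\<in>X. \<Union>b\<in>Y. lcoset L (a + b))"

definition quot_mult :: "'r::ring_1 set \<Rightarrow> 'r \<Rightarrow> 'r set \<Rightarrow> 'r set" where
  "quot_mult L r X = (\<Union>a\<in>X. lcoset L (r * a))"

definition verma ::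
  "(complex \<Rightarrow> 'g::ab_group_add \<Rightarrow> 'g) \<Rightarrow> ('g \<Rightarrow> 'g \<Rightarrow> 'g) \<Rightarrow> ('h \<Rightarrow> 'g) \<Rightarrow> ('i \<Rightarrow> 'g) \<Rightarrow>
   ('h \<Rightarrow> complex) \<Rightarrow> 'g free_alg set set" where
  "verma sg br \<iota> e lam = range (lcoset (verma_ideal sg br \<iota> e lam))"

definition verma_add ::
  "(complex \<Rightarrow> 'g::ab_group_add \<Rightarrow> 'g) \<Rightarrow> ('g \<Rightarrow> 'g \<Rightarrow> 'g) \<Rightarrow> ('h \<Rightarrow> 'g) \<Rightarrow> ('i \<Rightarrow> 'g) \<Rightarrow>
   ('h \<Rightarrow> complex) \<Rightarrow> 'g free_alg set \<Rightarrow> 'g free_alg set \<Rightarrow> 'g free_alg set" where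
  "verma_add sg br \<iota> e lam = quot_add (verma_ideal sg br \<iota> e lam)"

definition verma_scale ::
  "(complex \<Rightarrow> 'g::ab_group_add \<Rightarrow> 'g) \<Rightarrow> ('g \<Rightarrow> 'g \<Rightarrow> 'g) \<Rightarrow> ('h \<Rightarrow> 'g) \<Rightarrow> ('i \<Rightarrow> 'g) \<Rightarrow>
   ('h \<Rightarrow> complex) \<Rightarrow> complex \<Rightarrow> 'g free_alg set \<Rightarrow> 'g free_alg set" where
  "verma_scale sg br \<iota> e lam c = quot_mult (verma_ideal sg br \<iota> e lam) (scalar c)"

definition verma_act ::
  "(complex \<Rightarrow> 'g::ab_group_add \<Rightarrow> 'g) \<Rightarrow> ('g \<Rightarrow> 'g \<Rightarrow> 'g) \<Rightarrow> ('h \<Rightarrow> 'g) \<Rightarrow> ('i \<Rightarrow> 'g) \<Rightarrow>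
   ('h \<Rightarrow> complex) \<Rightarrow> 'g \<Rightarrow> 'g free_alg set \<Rightarrow> 'g free_alg set" where
  "verma_act sg br \<iota> e lam x = quot_mult (verma_ideal sg br \<iota> e lam) (letter x)"


section \<open>Highest weight modules\<close>

locale lie_module = v: vector_space sv
  for sg :: "complex \<Rightarrow> 'g::ab_group_add \<Rightarrow> 'g" and br :: "'g \<Rightarrow> 'g \<Rightarrow> 'g"
    and sv :: "complex \<Rightarrow> 'v::ab_group_add \<Rightarrow> 'v" +
  fixes act :: "'g \<Rightarrow> 'v \<Rightarrow> 'v"
  assumes act_linear_left: "\<And>v. Vector_Spaces.linear sg sv (\<lambda>x. act x v)"
    and act_linear_right: "\<And>x. Vector_Spaces.linear sv sv (act x)"
    and act_br: "\<And>x y v. act (br x y) v = act x (act y v) - act y (act x v)"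

text \<open>
  A nonzero module that is a quotient of the Verma module, i.e. the image of a surjective module
  homomorphism \<open>\<pi>\<close> from it.
\<close>

definition highest_weight_module ::
  "(complex \<Rightarrow> 'g::ab_group_add \<Rightarrow> 'g) \<Rightarrow> ('g \<Rightarrow> 'g \<Rightarrow> 'g) \<Rightarrow> ('h \<Rightarrow> 'g) \<Rightarrow> ('i \<Rightarrow> 'g) \<Rightarrow>
   ('h \<Rightarrow> complex) \<Rightarrow> (complex \<Rightarrow> 'v::ab_group_add \<Rightarrow> 'v) \<Rightarrow> ('g \<Rightarrow> 'v \<Rightarrow> 'v) \<Rightarrow> bool" where
  "highest_weight_module sg br \<iota> e lam sv act \<longleftrightarrow>
     lie_module sg br sv act \<and> (\<exists>v :: 'v. v \<noteq> 0) \<and>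
     (\<exists>\<pi>. (\<forall>X\<in>verma sg br \<iota> e lam. \<forall>Y\<in>verma sg br \<iota> e lam.
             \<pi> (verma_add sg br \<iota> e lam X Y) = \<pi> X + \<pi> Y) \<and>
          (\<forall>c. \<forall>X\<in>verma sg br \<iota> e lam. \<pi> (verma_scale sg br \<iota> e lam c X) = sv c (\<pi> X)) \<and>
          (\<forall>x. \<forall>X\<in>verma sg br \<iota> e lam. \<pi> (verma_act sg br \<iota> e lam x X) = act x (\<pi> X)) \<and>
          \<pi> ` verma sg br \<iota> e lam = UNIV)"

definition wt ::
  "(complex \<Rightarrow> 'h::ab_group_add \<Rightarrow> 'h) \<Rightarrow> ('h \<Rightarrow> 'g) \<Rightarrow> (complex \<Rightarrow> 'v::ab_group_add \<Rightarrow> 'v) \<Rightarrow>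
   ('g \<Rightarrow> 'v \<Rightarrow> 'v) \<Rightarrow> ('h \<Rightarrow> complex) set" where
  "wt sh \<iota> sv act = {\<mu> \<in> dual_space sh. \<exists>v. v \<noteq> 0 \<and> (\<forall>x. act (\<iota> x) v = sv (\<mu> x) v)}"


section \<open>Holes\<close>

text \<open>In the next three definitions \<open>W\<close> stands for the set of weights of the module.\<close>

definition J_lam :: "('i \<Rightarrow> 'h) \<Rightarrow> ('h \<Rightarrow> complex) \<Rightarrow> 'i set" where
  "J_lam coroot lam = {i. lam (coroot i) \<in> \<nat>}"

definition is_hole ::
  "int ^ 'i::finite ^ 'i \<Rightarrow> ('i \<Rightarrow> 'h) \<Rightarrow> ('i \<Rightarrow> 'h \<Rightarrow> complex) \<Rightarrow> ('h \<Rightarrow> complex) \<Rightarrow>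
   ('h \<Rightarrow> complex) set \<Rightarrow> 'i set \<Rightarrow> bool" where
  "is_hole A coroot sroot lam W I \<longleftrightarrow> I \<subseteq> J_lam coroot lam \<and> independent_nodes A I \<and>
     lam - root_comb sroot (\<lambda>i. if i \<in> I then lam (coroot i) + 1 else 0) \<notin> W"

definition J_V ::
  "int ^ 'i::finite ^ 'i \<Rightarrow> ('i \<Rightarrow> 'h) \<Rightarrow> ('i \<Rightarrow> 'h \<Rightarrow> complex) \<Rightarrow> ('h \<Rightarrow> complex) \<Rightarrow>
   ('h \<Rightarrow> complex) set \<Rightarrow> 'i set" where
  "J_V A coroot sroot lam W =
     \<Union>{I. is_hole A coroot sroot lam W I \<and> (\<forall>I'. I' \<subset> I \<longrightarrow> \<not> is_hole A coroot sroot lam W I')}"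

end

theory Submission
  imports Defs "HOL-Library.Multiset"
begin

text \<open>
  Write the weights of \<open>V\<close> as \<open>\<lambda> - \<Sum>\<^sub>i x\<^sub>i \<alpha>\<^sub>i\<close>.  By \<open>sl\<^sub>2\<close>-theory, a weight \<open>\<nu>\<close> with \<open>\<langle>\<nu>, \<alpha>\<^sub>i\<^sup>\<or>\<rangle> \<ge> 0\<close> comes with
  the whole interval \<open>[s\<^sub>i \<nu>, \<nu>]\<close>.  So it is enough to find a climb from \<open>\<mu>\<close>, a chain of steps from
  \<open>\<nu> - k \<alpha>\<^sub>i\<close> up to \<open>\<nu>\<close> with \<open>0 < k \<le> \<langle>\<nu>, \<alpha>\<^sub>i\<^sup>\<or>\<rangle>\<close>, whose end has the required shape and is a weight of \<open>V\<close>: all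
  intermediate members are then weights too, and the first step gives the first claim.

  The climb has two parts.  The first one (lemma \<open>free_nodes_and_climb\<close>) finds a set \<open>J\<close> of nodes such
  that \<open>\<mu>\<close> climbs along \<open>J\<close> to \<open>\<lambda> - \<Sum>\<^sub>i\<^sub>\<notin>\<^sub>J x\<^sub>i \<alpha>\<^sub>i\<close> and such that no product of operators \<open>f\<^sub>i\<close> for independent
  nodes \<open>i \<notin> J\<close> annihilates the highest weight vector.  To find \<open>J\<close>, start with the highest weight
  vector \<open>w\<close> and with the set \<open>D\<close> of all nodes, and consider the singular vectors
  \<open>w\<^sub>i = f\<^sub>i\<^sup>m\<^sup>+\<^sup>1 w\<close>, where \<open>i \<in> D\<close> and \<open>m\<close> is the label of \<open>w\<close> at \<open>i\<close>.  If \<open>\<mu>\<close> is a weight of the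
  quotient by these vectors, which is integrable in the directions \<open>D\<close>, then reflections make it climb
  along \<open>J = D\<close> (lemma \<open>climbs_in_integrable_quotient\<close>).  Otherwise \<open>\<mu>\<close> is a weight of the submodule
  generated by some \<open>w\<^sub>i\<close>; replace \<open>w\<close> by \<open>w\<^sub>i\<close> and \<open>D\<close> by \<open>D - {i}\<close>.  Nonvanishing of products of the
  \<open>f\<^sub>i\<close> passes back from \<open>w\<^sub>i\<close> to \<open>w\<close>, because by the Serre relations a vector annihilated by some word in
  given letters remains so, with a longer word in these letters, after lowering (lemma \<open>annihilator_transfer\<close>).

  The second part (lemma \<open>climbs_to_independent\<close>) is combinatorial: repeatedly remove from the support a
  node \<open>i\<close> that can be removed in one step.  If there is none, the support is independent and
  \<open>x\<^sub>i > \<langle>\<lambda>, \<alpha>\<^sub>i\<^sup>\<or>\<rangle>\<close> on it.  As the support is then an independent set outside \<open>J\<close>, the end of the climb is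
  a weight of \<open>V\<close>.
\<close>

section \<open>Climbing in the cone below a weight\<close>

text \<open>
  If \<open>a i = \<lambda>(\<alpha>\<^sub>i\<^sup>\<or>)\<close>, this is the integer \<open>\<langle>\<nu>, \<alpha>\<^sub>i\<^sup>\<or>\<rangle>\<close> for \<open>\<nu> = \<lambda> - \<Sum>\<^sub>j\<^sub>\<in>\<^sub>x \<alpha>\<^sub>j\<close>.  Degrees below \<open>\<lambda>\<close>
  are multisets of nodes, so that the support is the underlying set and the pairing is additive.
\<close>
definition label :: "int ^ 'i ^ 'i \<Rightarrow> ('i \<Rightarrow> nat) \<Rightarrow> 'i \<Rightarrow> 'i::finite multiset \<Rightarrow> int" where
  "label A a i x = int (a i) - (\<Sum>j\<in>#x. A $ i $ j)"

lemma label_union [simp]: "label A a i (x + y) = label A a i x - (\<Sum>j\<in>#y. A $ i $ j)"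
  by (simp add: label_def)

text \<open>
  Let \<open>\<nu>\<close> be the weight of degree \<open>y\<close>.  A step passes from \<open>\<nu> - k \<alpha>\<^sub>i\<close> up to \<open>\<nu>\<close>, and the conditions on \<open>k\<close>
  say that \<open>\<nu> - k \<alpha>\<^sub>i \<noteq> \<nu>\<close> lies in the interval \<open>[s\<^sub>i \<nu>, \<nu>]\<close>.
\<close>
inductive climbs :: "int ^ 'i ^ 'i \<Rightarrow> ('i \<Rightarrow> nat) \<Rightarrow> 'i::finite set \<Rightarrow> 'i multiset \<Rightarrow> 'i multiset \<Rightarrow> bool"
  for A a J where
  refl: "climbs A a J x x"
| step: "\<lbrakk>climbs A a J y z; i \<in> J; 0 < k; int k \<le> label A a i y\<rbrakk>
    \<Longrightarrow> climbs A a J (y + replicate_mset k i) z"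

lemma climbs_subset: "climbs A a J x z \<Longrightarrow> z \<subseteq># x"
  by (induction rule: climbs.induct) (auto intro: subset_mset.order_trans)

lemma climbs_trans: "climbs A a J x y \<Longrightarrow> climbs A a J y z \<Longrightarrow> climbs A a J x z"
  by (induction rule: climbs.induct) (auto intro: climbs.step)

lemma climbs_mono: "climbs A a J x z \<Longrightarrow> J \<subseteq> J' \<Longrightarrow> climbs A a J' x z"
  by (induction rule: climbs.induct) (auto intro: climbs.intros)

lemma climbs_restrict: "climbs A a J x z \<Longrightarrow> climbs A a (J \<inter> set_mset x) x z"
proof (induction rule: climbs.induct)
  case (step y z i k)
  then have "climbs A a (J \<inter> set_mset (y + replicate_mset k i)) y z"
    by (auto intro: climbs_mono)
  then show ?case using step by (intro climbs.step) auto
qed (rule climbs.refl)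

text \<open>
  Lowering all weights of a climb by \<open>\<alpha>\<^sub>i\<close> keeps it a climb when \<open>i \<notin> J\<close>, since the pairings with the
  \<open>\<alpha>\<^sub>j\<^sup>\<or>\<close>, \<open>j \<in> J\<close>, can only grow.  This lets the steps along \<open>J\<close> ignore the other nodes.
\<close>
lemma climbs_shift:
  assumes "gcm A"
  shows "climbs A a J x z \<Longrightarrow> i \<notin> J \<Longrightarrow> climbs A a J (add_mset i x) (add_mset i z)"
proof (induction rule: climbs.induct)
  case (step y z j k)
  have "A $ j $ i \<le> 0" using assms step unfolding gcm_def by metis
  then have "int k \<le> label A a j (add_mset i y)" using step by (simp add: label_def)
  from climbs.step[OF step.IH[OF step.prems] step.hyps(2,3) this] show ?case by simp
qed (rule climbs.refl)

lemma climbs_chain: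
  assumes "climbs A a J x z"
  shows "\<exists>n ms nodes. ms (0::nat) = x \<and> ms n = z \<and> (\<forall>t\<le>n. climbs A a J (ms t) z) \<and>
    (\<forall>t. 1 \<le> t \<longrightarrow> t \<le> n \<longrightarrow> nodes t \<in> J \<and>
      (\<exists>k>0. ms (t - 1) = ms t + replicate_mset k (nodes t) \<and> int k \<le> label A a (nodes t) (ms t)))"
  using assms
proof (induction rule: climbs.induct)
  case (refl x)
  show ?case by (rule exI[of _ 0], rule exI[of _ "\<lambda>_. x"]) (simp add: climbs.refl)
next
  case (step y z i k)
  then obtain n ms nodes where c: "ms (0::nat) = y" "ms n = z" "\<forall>t\<le>n. climbs A a J (ms t) z"
    "\<forall>t. 1 \<le> t \<longrightarrow> t \<le> n \<longrightarrow> nodes t \<in> J \<and>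
    (\<exists>k>0. ms (t - 1) = ms t + replicate_mset k (nodes t) \<and> int k \<le> label A a (nodes t) (ms t))"
    by auto
  let ?ms = "case_nat (y + replicate_mset k i) ms"
  let ?no = "\<lambda>t. if t = 1 then i else nodes (t - 1)"
  have up: "climbs A a J (y + replicate_mset k i) z" using step by (auto intro: climbs.step)
  have 1: "?ms 0 = y + replicate_mset k i" by simp
  have 2: "?ms (Suc n) = z" using c by simp
  have 3: "\<forall>t\<le>Suc n. climbs A a J (?ms t) z" using c up by (auto split: nat.split)
  have 4: "\<forall>t. 1 \<le> t \<longrightarrow> t \<le> Suc n \<longrightarrow> ?no t \<in> J \<and> (\<exists>k>0. ?ms (t - 1) = ?ms t + replicate_mset k (?no t) \<and>
     int k \<le> label A a (?no t) (?ms t))"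
  proof (intro allI impI)
    fix t :: nat assume t: "1 \<le> t" "t \<le> Suc n"
    show "?no t \<in> J \<and> (\<exists>k>0. ?ms (t - 1) = ?ms t + replicate_mset k (?no t) \<and>
     int k \<le> label A a (?no t) (?ms t))"
    proof (cases "t = 1")
      case True
      then show ?thesis using step c(1) by auto
    next
      case False
      define s where "s = t - 2"
      have "t = Suc (Suc s)" "Suc s \<le> n" using t False by (auto simp: s_def)
      then show ?thesis using c(4)[rule_format, of "Suc s"] by simp
    qed
  qed
  show ?case
    by (rule exI[of _ "Suc n"], rule exI[of _ ?ms], rule exI[of _ ?no], intro conjI) (fact 1 2 3 4)+
qed

lemma sum_mset_nonpos: "(\<And>j. j \<in># M \<Longrightarrow> g j \<le> 0) \<Longrightarrow> (\<Sum>j\<in>#M. g j) \<le> (0::int)"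
  by (induction M) (auto intro: add_nonpos_nonpos)

text \<open>
  As long as some node can be removed entirely in one admissible step, remove it.  When no node can,
  \<open>\<langle>\<lambda>, \<alpha>\<^sub>i\<^sup>\<or>\<rangle> + \<Sum>\<^sub>j\<^sub>\<noteq>\<^sub>i \<bar>A\<^sub>i\<^sub>j\<bar> x\<^sub>j < x\<^sub>i\<close> for all \<open>i\<close> in the support.  In particular \<open>\<langle>\<lambda>, \<alpha>\<^sub>i\<^sup>\<or>\<rangle> < x\<^sub>i\<close>; and
  there is no edge inside the support, because a node of least multiplicity among those having a
  neighbour would violate the inequality.
\<close>
lemma climbs_to_independent:
  assumes A: "gcm A"
  shows "\<exists>z. climbs A a (set_mset x) x z \<and> independent_nodes A (set_mset z) \<and> (\<forall>i\<in>#z. a i < count z i)"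
proof (induction "size x" arbitrary: x rule: less_induct)
  case less
  let ?r = "\<lambda>i. filter_mset (\<lambda>j. j \<noteq> i) x"
  have split: "x = ?r i + replicate_mset (count x i) i" for i
    by (rule multiset_eqI) simp
  have neg: "A $ i $ j \<le> 0" if "j \<noteq> i" for i j using A that unfolding gcm_def by metis
  show ?case
  proof (cases "\<exists>i. i \<in># x \<and> int (count x i) \<le> label A a i (?r i)")
    case True
    then obtain i where i: "i \<in># x" "int (count x i) \<le> label A a i (?r i)" by blast
    have "size (?r i) < size x" using i(1)
      by (metis (mono_tags) count_filter_mset filter_mset_eq_conv multiset_filter_subset
          not_in_iff mset_subset_size subset_mset.le_imp_less_or_eq)
    from less[OF this] obtain z where z: "climbs A a (set_mset (?r i)) (?r i) z"
      "independent_nodes A (set_mset z)" "\<forall>i\<in>#z. a i < count z i" by blast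
    have "climbs A a (set_mset x) (?r i) z" by (rule climbs_mono[OF z(1)]) auto
    then have "climbs A a (set_mset x) (?r i + replicate_mset (count x i) i) z"
      by (rule climbs.step) (use i in auto)
    then show ?thesis using z split[of i] by metis
  next
    case False
    then have big: "label A a i (?r i) < int (count x i)" if "i \<in># x" for i using that by force
    have ge: "int (a i) \<le> label A a i (?r i)" for i
      unfolding label_def by (simp, rule sum_mset_nonpos) (auto intro: neg)
    have "independent_nodes A (set_mset x)"
    proof (rule ccontr)
      assume n: "\<not> ?thesis"
      define X where "X = {i. i \<in># x \<and> (\<exists>j\<in>#x. dynkin_edge A i j)}"
      have "X \<noteq> {}" using n by (auto simp: independent_nodes_def X_def)
      then obtain i where "is_arg_min (count x) (\<lambda>i. i \<in> X) i"
        using ex_is_arg_min_if_finite[of X "count x"] finite by blast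
      then have i: "i \<in> X" "\<And>j. j \<in> X \<Longrightarrow> count x i \<le> count x j"
        by (auto simp: is_arg_min_linorder)
      then obtain j where j: "j \<in># x" "i \<noteq> j" "A $ i $ j \<noteq> 0"
        by (auto simp: X_def dynkin_edge_def)
      have "A $ j $ i \<noteq> 0" using j A unfolding gcm_def by metis
      then have "j \<in> X" using i j by (force simp: X_def dynkin_edge_def)
      then have le: "count x i \<le> count x j" using i by blast
      let ?s = "filter_mset (\<lambda>k. k \<noteq> i \<and> k \<noteq> j) x"
      have "?r i = ?s + replicate_mset (count x j) j" using j by (intro multiset_eqI) auto
      then have "label A a i (?r i) = label A a i ?s - int (count x j) * A $ i $ j"
        by simp
      moreover have "0 \<le> label A a i ?s"
        using sum_mset_nonpos[of ?s "\<lambda>k. A $ i $ k"] neg by (simp add: label_def order_trans)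
      moreover have "int (count x j) \<le> - (int (count x j) * A $ i $ j)"
        using neg[of j i] j mult_left_mono[of 1 "- A $ i $ j" "int (count x j)"] by simp
      ultimately show False using big[of i] le i by (auto simp: X_def)
    qed
    moreover have "\<forall>i\<in>#x. a i < count x i" using big ge by (metis of_nat_less_iff order_le_less_trans)
    ultimately show ?thesis using climbs.refl by blast
  qed
qed

section \<open>Strings of \<open>sl\<^sub>2\<close> modulo a submodule\<close>

text \<open>
  The vector \<open>u\<close> is a highest weight vector of weight \<open>c\<close> modulo the submodule \<open>N\<close>, for an \<open>sl\<^sub>2\<close>-triple
  \<open>E\<close>, \<open>H\<close>, \<open>F\<close>.  Strings going up are covered by exchanging \<open>E\<close> and \<open>F\<close> and negating \<open>H\<close>.
\<close>
locale sl2_string = vector_space scale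
  for scale :: "complex \<Rightarrow> 'v::ab_group_add \<Rightarrow> 'v" +
  fixes E F H :: "'v \<Rightarrow> 'v" and u :: 'v and c :: complex and N :: "'v set"
  assumes linear_F: "Vector_Spaces.linear scale scale F"
    and comm: "\<And>w. E (F w) = F (E w) + H w"
    and weight: "\<And>p. H ((F ^^ p) u) = scale (c - 2 * of_nat p) ((F ^^ p) u)"
    and N: "subspace N"
    and E_N: "\<And>w. w \<in> N \<Longrightarrow> E w \<in> N"
    and F_N: "\<And>w. w \<in> N \<Longrightarrow> F w \<in> N"
    and top: "E u \<in> N"
begin

lemma e_f_power:
  "E ((F ^^ Suc p) u) = (F ^^ Suc p) (E u) + scale (of_nat (Suc p) * (c - of_nat p)) ((F ^^ p) u)"
proof -
  interpret F: Vector_Spaces.linear scale scale F by (rule linear_F)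
  show ?thesis
  proof (induction p)
    case 0
    then show ?case using comm[of u] weight[of 0] by simp
  next
    case (Suc p)
    have "E ((F ^^ Suc (Suc p)) u) = F (E ((F ^^ Suc p) u)) + H ((F ^^ Suc p) u)"
      using comm by simp
    also have "F (E ((F ^^ Suc p) u)) = (F ^^ Suc (Suc p)) (E u) + scale (of_nat (Suc p) * (c - of_nat p)) ((F ^^ Suc p) u)"
      unfolding Suc.IH by (simp add: F.add F.scale)
    also have "H ((F ^^ Suc p) u) = scale (c - 2 * of_nat (Suc p)) ((F ^^ Suc p) u)"
      by (rule weight)
    finally have "E ((F ^^ Suc (Suc p)) u) = (F ^^ Suc (Suc p)) (E u)
        + scale (of_nat (Suc p) * (c - of_nat p) + (c - 2 * of_nat (Suc p))) ((F ^^ Suc p) u)"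
      by (simp add: scale_left_distrib add.assoc)
    also have "of_nat (Suc p) * (c - of_nat p) + (c - 2 * of_nat (Suc p))
        = of_nat (Suc (Suc p)) * (c - of_nat (Suc p))"
      by (simp add: algebra_simps)
    finally show ?case .
  qed
qed

lemma funpow_N: "w \<in> N \<Longrightarrow> (F ^^ p) w \<in> N"
  by (induction p) (auto intro: F_N)

text \<open>
  Apply \<open>E\<close>: the vector \<open>F\<^sup>p u\<close> is recovered from \<open>E F\<^sup>p\<^sup>+\<^sup>1 u\<close> modulo \<open>N\<close> up to the factor \<open>(p + 1) (c - p)\<close>,
  so the string can enter \<open>N\<close> only right after \<open>p = c\<close>.
\<close>
lemma descend:
  assumes "(F ^^ Suc p) u \<in> N" and "c \<noteq> of_nat p"
  shows "(F ^^ p) u \<in> N"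
proof -
  have "scale (of_nat (Suc p) * (c - of_nat p)) ((F ^^ p) u) = E ((F ^^ Suc p) u) - (F ^^ Suc p) (E u)"
    using e_f_power[of p] by simp
  also have "\<dots> \<in> N"
    using N E_N[OF assms(1)] funpow_N[OF top, of "Suc p"] by (rule subspace_diff)
  finally have *: "scale (of_nat (Suc p) * (c - of_nat p)) ((F ^^ p) u) \<in> N" .
  have nz: "of_nat (Suc p) * (c - of_nat p) \<noteq> 0"
    using assms(2) by (simp del: of_nat_Suc)
  show ?thesis
    using subspace_scale[OF N *, of "1 / (of_nat (Suc p) * (c - of_nat p))"] nz by simp
qed

lemma string_survives:
  assumes "u \<notin> N" and "c = of_nat m" and "p \<le> m"
  shows "(F ^^ p) u \<notin> N"
  using assms(3)
proof (induction p)
  case (Suc p)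
  then show ?case using descend[of p] assms(2) by auto
qed (use assms(1) in simp)

text \<open>Past \<open>p = m\<close> the factors \<open>(p + 1) (m - p)\<close> never vanish, so a string that is still outside \<open>N\<close> there never enters it.\<close>
lemma free_beyond_singular:
  assumes "(F ^^ Suc m) u \<notin> N" and "c = of_nat m"
  shows "(F ^^ p) u \<notin> N"
proof (cases "p \<le> Suc m")
  case True
  then have "(F ^^ Suc m) u = (F ^^ (Suc m - p)) ((F ^^ p) u)"
    by (metis funpow_add comp_apply le_add_diff_inverse2)
  then show ?thesis using assms(1) funpow_N by metis
next
  case False
  then have "Suc m \<le> p" by simp
  then show ?thesis
  proof (induction p rule: dec_induct)
    case (step n)
    then show ?case using descend[of n] assms(2) by auto
  qed (use assms(1) in simp)
qed

end

section \<open>Weights below a fixed weight\<close>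

definition below :: "('i \<Rightarrow> 'h \<Rightarrow> complex) \<Rightarrow> ('h \<Rightarrow> complex) \<Rightarrow> 'i multiset \<Rightarrow> 'h \<Rightarrow> complex" where
  "below sroot lam x = (\<lambda>h. lam h - (\<Sum>j\<in>#x. sroot j h))"

lemma below_empty [simp]: "below sroot lam {#} = lam"
  by (simp add: below_def)

lemma below_add: "below sroot lam (add_mset i x) h = below sroot lam x h - sroot i h"
  by (simp add: below_def)

lemma sum_mset_root_comb:
  "(\<Sum>j\<in>#x. sroot j h) = root_comb sroot (\<lambda>i. of_nat (count x i)) h"
proof (induction x)
  case (add k x)
  have "of_nat (count (add_mset k x) i) * sroot i h
      = of_nat (count x i) * sroot i h + (if i = k then sroot i h else 0)" for i
    by (simp add: distrib_right)
  then show ?case using add by (simp add: root_comb_def sum.distrib)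
qed (simp add: root_comb_def)

lemma below_eq_root_comb: "below sroot lam x = lam - root_comb sroot (\<lambda>i. of_nat (count x i))"
  by (simp add: fun_eq_iff below_def sum_mset_root_comb)

lemma wt_le_below: "wt_le sroot (below sroot lam (y + x)) (below sroot lam y)"
  unfolding wt_le_def
  by (rule exI[of _ "count x"]) (simp add: fun_eq_iff below_def sum_mset_root_comb[symmetric])

context realization
begin

lemma below_eq_iff: "below sroot lam x = below sroot lam y \<longleftrightarrow> x = y"
proof
  assume eq: "below sroot lam x = below sroot lam y"
  have "(\<Sum>i\<in>UNIV. (of_nat (count x i) - of_nat (count y i)) * sroot i h) = 0" for h
    using fun_cong[OF eq, of h]
    by (simp add: below_def sum_mset_root_comb root_comb_def left_diff_distrib sum_subtractf)
  from root_indep[rule_format, OF this] show "x = y"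
    by (intro multiset_eqI) (simp add: fun_eq_iff)
qed simp

lemma below_coroot:
  assumes "lam (coroot i) = of_nat (a i)"
  shows "below sroot lam x (coroot i) = of_int (label A a i x)"
  by (induction x) (simp_all add: below_def label_def assms pairing)

lemma sroot_self: "sroot i (coroot i) = 2"
  using gcm by (simp add: pairing gcm_def)

lemma supp_below: "supp sroot (lam - below sroot lam x) = set_mset x"
proof -
  have eq: "lam - below sroot lam x = root_comb sroot (\<lambda>i. of_nat (count x i))"
    by (simp add: below_eq_root_comb fun_eq_iff)
  have "root_coeff sroot (root_comb sroot c) = c" for c
    unfolding root_coeff_def
  proof (rule the_equality)
    fix d assume "root_comb sroot c = root_comb sroot d"
    then have "(\<Sum>i\<in>UNIV. (d i - c i) * sroot i x) = 0" for x
      by (simp add: root_comb_def fun_eq_iff left_diff_distrib sum_subtractf)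
    from root_indep[rule_format, OF this] show "d = c" by (simp add: fun_eq_iff)
  qed simp
  then show ?thesis by (auto simp: supp_def eq)
qed

lemma below_dual: "lam \<in> dual_space sh \<Longrightarrow> below sroot lam x \<in> dual_space sh"
proof (induction x)
  case (add i x)
  have "below sroot lam (add_mset i x) = (\<lambda>h. below sroot lam x h - sroot i h)"
    by (simp add: fun_eq_iff below_add)
  then show ?case
    using add root_dual[of i] unfolding dual_space_def Vector_Spaces.linear_iff
    by (simp add: algebra_simps)
qed simp

text \<open>Evaluation at \<open>\<alpha>\<^sub>i\<^sup>\<or>\<close> shows that \<open>m\<close> is the only \<open>k\<close> with \<open>s\<^sub>i \<nu> = \<nu> - k \<alpha>\<^sub>i\<close>.\<close>
lemma wt_interval_reflection:
  assumes "\<nu> (coroot i) = of_nat m"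
  shows "wt_interval (sroot i) (simple_reflection coroot sroot i \<nu>) \<nu>
    = {(\<lambda>z. \<nu> z - of_nat j * sroot i z) | j. j \<le> m}"
proof -
  have "simple_reflection coroot sroot i \<nu> = (\<lambda>z. \<nu> z - of_nat k * sroot i z) \<longleftrightarrow> k = m" for k
  proof
    assume "simple_reflection coroot sroot i \<nu> = (\<lambda>z. \<nu> z - of_nat k * sroot i z)"
    from fun_cong[OF this, of "coroot i"] show "k = m"
      by (simp add: simple_reflection_def assms sroot_self)
  qed (simp add: simple_reflection_def assms)
  then show ?thesis unfolding wt_interval_def by auto
qed

end

section \<open>Weight vectors and words in the lowering operators\<close>

text \<open>Modules in general, so that the adjoint one, from which the Serre relations come, is covered as well.\<close>
locale km_module = kac_moody_algebra A sh coroot sroot sg br \<iota> e f + lie_module sg br sv act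
  for A :: "int ^ 'i::finite ^ 'i" and sh :: "complex \<Rightarrow> 'h::ab_group_add \<Rightarrow> 'h"
    and coroot :: "'i \<Rightarrow> 'h" and sroot :: "'i \<Rightarrow> 'h \<Rightarrow> complex"
    and sg :: "complex \<Rightarrow> 'g::ab_group_add \<Rightarrow> 'g" and br :: "'g \<Rightarrow> 'g \<Rightarrow> 'g"
    and \<iota> :: "'h \<Rightarrow> 'g" and e f :: "'i \<Rightarrow> 'g"
    and sv :: "complex \<Rightarrow> 'v::ab_group_add \<Rightarrow> 'v" and act :: "'g \<Rightarrow> 'v \<Rightarrow> 'v"
begin

sublocale act_r: Vector_Spaces.linear sv sv "act x" for x
  by (rule act_linear_right)

sublocale act_l: Vector_Spaces.linear sg sv "\<lambda>x. act x u" for u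
  by (rule act_linear_left)

lemma act_commute: "act x (act y u) = act y (act x u) + act (br x y) u"
  by (simp add: act_br)

definition weight_vec :: "('h \<Rightarrow> complex) \<Rightarrow> 'v \<Rightarrow> bool" where
  "weight_vec \<omega> u \<longleftrightarrow> (\<forall>x. act (\<iota> x) u = sv (\<omega> x) u)"

lemma weight_vec_f: "weight_vec \<omega> u \<Longrightarrow> weight_vec (\<lambda>x. \<omega> x - sroot i x) (act (f i) u)"
  unfolding weight_vec_def by (simp add: act_commute[of "\<iota> _"] hf act_l.scale act_l.neg act_r.scale v.scale_left_diff_distrib)

lemma weight_vec_e: "weight_vec \<omega> u \<Longrightarrow> weight_vec (\<lambda>x. \<omega> x + sroot i x) (act (e i) u)"
  unfolding weight_vec_def by (simp add: act_commute[of "\<iota> _"] he act_l.scale act_r.scale v.scale_left_distrib)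

lemma weight_vec_f_pow: "weight_vec \<omega> u \<Longrightarrow> weight_vec (\<lambda>x. \<omega> x - of_nat p * sroot i x) ((act (f i) ^^ p) u)"
proof (induction p)
  case (Suc p)
  have "(\<lambda>x. \<omega> x - of_nat p * sroot i x - sroot i x) = (\<lambda>x. \<omega> x - of_nat (Suc p) * sroot i x)"
    by (simp add: fun_eq_iff algebra_simps)
  then show ?case using weight_vec_f[OF Suc.IH[OF Suc.prems], of i] by simp
qed simp

lemma weight_vec_e_pow: "weight_vec \<omega> u \<Longrightarrow> weight_vec (\<lambda>x. \<omega> x + of_nat p * sroot i x) ((act (e i) ^^ p) u)"
proof (induction p)
  case (Suc p)
  have "(\<lambda>x. \<omega> x + of_nat p * sroot i x + sroot i x) = (\<lambda>x. \<omega> x + of_nat (Suc p) * sroot i x)"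
    by (simp add: fun_eq_iff algebra_simps)
  then show ?case using weight_vec_e[OF Suc.IH[OF Suc.prems], of i] by simp
qed simp

text \<open>
  Linear independence of weight spaces: subtracting the components of weight \<open>\<mu>\<close>, the rest is a
  vector of weight \<open>\<mu>\<close> that is a sum of vectors of other weights, hence zero.
\<close>
lemma weight_component:
  assumes u: "weight_vec \<mu> u" and span: "u \<in> v.span G" and G: "\<And>g. g \<in> G \<Longrightarrow> \<exists>\<omega>. weight_vec \<omega> g"
  shows "u \<in> v.span {g \<in> G. weight_vec \<mu> g}"
proof -
  let ?G0 = "{g \<in> G. weight_vec \<mu> g}" and ?G1 = "{g \<in> G. \<not> weight_vec \<mu> g}"
  define \<omega> where "\<omega> g = (SOME \<nu>. weight_vec \<nu> g)" for g
  have \<omega>: "weight_vec (\<omega> g) g" if "g \<in> G" for g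
    unfolding \<omega>_def using someI_ex[OF G[OF that]] .
  have elim: "y = 0" if "finite t" "t \<subseteq> ?G1" "weight_vec \<mu> y" "y = (\<Sum>g\<in>t. sv (r g) g)" for t y r
    using that
  proof (induction t arbitrary: y r rule: finite_induct)
    case (insert g0 t)
    have "\<omega> g0 \<noteq> \<mu>" using \<omega>[of g0] insert.prems(1) by auto
    then obtain x where x: "\<omega> g0 x \<noteq> \<mu> x" by (auto simp: fun_eq_iff)
    have act_g: "act (\<iota> x) (sv (r g) g) = sv (r g * \<omega> g x) g" if "g \<in> insert g0 t" for g
      using \<omega>[of g] that insert.prems(1) by (auto simp: weight_vec_def act_r.scale)
    have "sv (\<mu> x) y = act (\<iota> x) y" using insert.prems(2) by (simp add: weight_vec_def)
    also have "\<dots> = (\<Sum>g\<in>insert g0 t. sv (r g * \<omega> g x) g)"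
      unfolding insert.prems(3) act_r.sum by (rule sum.cong) (use act_g in auto)
    finally have *: "sv (\<mu> x) y = (\<Sum>g\<in>insert g0 t. sv (r g * \<omega> g x) g)" .
    have "sv (\<omega> g0 x) y = (\<Sum>g\<in>insert g0 t. sv (r g * \<omega> g0 x) g)"
      unfolding insert.prems(3) by (simp add: v.scale_sum_right mult.commute v.scale_right_distrib)
    with * have "sv (\<mu> x - \<omega> g0 x) y = (\<Sum>g\<in>insert g0 t. sv (r g * \<omega> g x) g - sv (r g * \<omega> g0 x) g)"
      by (simp add: v.scale_left_diff_distrib sum_subtractf)
    also have "\<dots> = (\<Sum>g\<in>t. sv (r g * (\<omega> g x - \<omega> g0 x)) g)"
      using insert.hyps by (simp add: right_diff_distrib v.scale_left_diff_distrib)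
    finally have "sv (\<mu> x - \<omega> g0 x) y = (\<Sum>g\<in>t. sv (r g * (\<omega> g x - \<omega> g0 x)) g)" .
    moreover have "weight_vec \<mu> (sv (\<mu> x - \<omega> g0 x) y)"
      using insert.prems(2) by (simp add: weight_vec_def act_r.scale mult.commute)
    ultimately have "sv (\<mu> x - \<omega> g0 x) y = 0"
      using insert.IH[of "sv (\<mu> x - \<omega> g0 x) y" "\<lambda>g. r g * (\<omega> g x - \<omega> g0 x)"] insert.prems(1)
      by simp
    then show ?case using x by simp
  qed simp
  have "G = ?G0 \<union> ?G1" by auto
  then have "u \<in> v.span (?G0 \<union> ?G1)" using span by simp
  then obtain a b where ab: "u = a + b" "a \<in> v.span ?G0" "b \<in> v.span ?G1"
    unfolding v.span_Un by auto
  have "v.subspace {y. weight_vec \<mu> y}"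
    unfolding v.subspace_def weight_vec_def
    by (auto simp: act_r.add act_r.scale v.scale_right_distrib mult.commute)
  then have "weight_vec \<mu> a" using v.span_minimal[of ?G0 "{y. weight_vec \<mu> y}"] ab(2) by blast
  then have "weight_vec \<mu> b" using u ab(1)
    by (auto simp: weight_vec_def act_r.add v.scale_right_distrib)
  moreover obtain t r where "finite t" "t \<subseteq> ?G1" "b = (\<Sum>g\<in>t. sv (r g) g)"
    using ab(3) unfolding v.span_explicit by blast
  ultimately have "b = 0" using elim[of t b r] by simp
  then show ?thesis using ab by simp
qed

definition lower_word :: "'i list \<Rightarrow> 'v \<Rightarrow> 'v" where
  "lower_word l u = foldr (\<lambda>i. act (f i)) l u"

lemma lower_word_simps [simp]: "lower_word [] u = u" "lower_word (i # l) u = act (f i) (lower_word l u)"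
  by (simp_all add: lower_word_def)

lemma lower_word_append [simp]: "lower_word (l @ l') u = lower_word l (lower_word l' u)"
  by (simp add: lower_word_def)

lemma lower_word_replicate: "lower_word (replicate n i) u = (act (f i) ^^ n) u"
  by (induction n) auto

lemma lower_word_zero [simp]: "lower_word l 0 = 0"
  by (induction l) (auto simp: act_r.zero)

lemma lower_word_weight_vec:
  assumes "weight_vec (below sroot lam y) w"
  shows "weight_vec (below sroot lam (mset l + y)) (lower_word l w)"
proof (induction l)
  case (Cons i l)
  have "below sroot lam (mset (i # l) + y) = (\<lambda>x. below sroot lam (mset l + y) x - sroot i x)"
    by (simp add: below_add fun_eq_iff)
  then show ?case using weight_vec_f[OF Cons.IH, of i] by simp
qed (use assms in simp)

definition f_stable :: "'v set \<Rightarrow> bool" where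
  "f_stable N \<longleftrightarrow> v.subspace N \<and> (\<forall>i. \<forall>u\<in>N. act (f i) u \<in> N)"

lemma lower_word_f_stable: "f_stable N \<Longrightarrow> u \<in> N \<Longrightarrow> lower_word l u \<in> N"
  by (induction l) (auto simp: f_stable_def)

lemma act_span:
  assumes "v.subspace N" and "\<And>s. s \<in> S \<Longrightarrow> act x s \<in> N" and "u \<in> v.span S"
  shows "act x u \<in> N"
proof -
  have "v.subspace {u. act x u \<in> N}"
    using assms(1) by (auto simp: v.subspace_def act_r.add act_r.scale act_r.zero)
  then show ?thesis using v.span_minimal[of S "{u. act x u \<in> N}"] assms(2,3) by blast
qed

text \<open>The zero vector is allowed, so that \<open>f\<^sub>i\<^sup>m\<^sup>+\<^sup>1 w\<close> always qualifies when \<open>w\<close> is maximal with label \<open>m\<close> at \<open>i\<close>.\<close>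
definition maximal_vec :: "('h \<Rightarrow> complex) \<Rightarrow> 'v \<Rightarrow> bool" where
  "maximal_vec \<omega> w \<longleftrightarrow> weight_vec \<omega> w \<and> (\<forall>i. act (e i) w = 0)"

text \<open>
  Commuting \<open>e\<^sub>i\<close> to the right past the letters \<open>f\<^sub>j\<close> kills the maximal vector and leaves, for each
  occurrence of \<open>f\<^sub>i\<close>, a multiple of the word without it.
\<close>
lemma raise_lower_word:
  assumes "maximal_vec (below sroot lam y) w"
  shows "act (e i) (lower_word l w) \<in> v.span {lower_word l' w | l'. mset l = add_mset i (mset l')}"
proof (induction l)
  case Nil
  then show ?case using assms by (simp add: maximal_vec_def v.span_zero)
next
  case (Cons j l)
  let ?T = "v.span {lower_word l' w | l'. mset (j # l) = add_mset i (mset l')}"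
  have 1: "act (f j) (act (e i) (lower_word l w)) \<in> ?T"
  proof (rule act_span[OF v.subspace_span _ Cons.IH])
    fix s assume "s \<in> {lower_word l' w | l'. mset l = add_mset i (mset l')}"
    then obtain l' where "s = lower_word l' w" "mset l = add_mset i (mset l')" by blast
    then show "act (f j) s \<in> ?T"
      by (intro v.span_base CollectI exI[of _ "j # l'"]) auto
  qed
  have 2: "act (br (e i) (f j)) (lower_word l w) \<in> ?T"
  proof (cases "i = j")
    case True
    have "lower_word l w \<in> ?T" using True by (intro v.span_base) auto
    moreover have "weight_vec (below sroot lam (mset l + y)) (lower_word l w)"
      using assms lower_word_weight_vec by (auto simp: maximal_vec_def)
    ultimately show ?thesis using True by (auto simp: ef weight_vec_def intro: v.span_scale)
  next
    case False
    then show ?thesis by (simp add: ef act_l.zero v.span_zero)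
  qed
  show ?case using v.span_add[OF 1 2] by (simp add: act_commute[of "e i"])
qed

lemma raise_pow_lower_word:
  assumes "maximal_vec (below sroot lam y) w"
  shows "(act (e i) ^^ m) (lower_word l w) \<in> v.span {lower_word l' w | l'. mset l = replicate_mset m i + mset l'}"
proof (induction m)
  case 0
  show ?case by (auto intro: v.span_base)
next
  case (Suc m)
  let ?T = "v.span {lower_word l' w | l'. mset l = replicate_mset (Suc m) i + mset l'}"
  have "act (e i) ((act (e i) ^^ m) (lower_word l w)) \<in> ?T"
  proof (rule act_span[OF v.subspace_span _ Suc.IH])
    fix s assume "s \<in> {lower_word l' w | l'. mset l = replicate_mset m i + mset l'}"
    then obtain l' where l': "s = lower_word l' w" "mset l = replicate_mset m i + mset l'" by blast
    have "{lower_word l'' w | l''. mset l' = add_mset i (mset l'')}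
        \<subseteq> {lower_word l' w | l'. mset l = replicate_mset (Suc m) i + mset l'}"
      using l' by auto
    then show "act (e i) s \<in> ?T"
      using raise_lower_word[OF assms, of i l'] l'(1) v.span_mono by blast
  qed
  then show ?case by simp
qed

lemma sl2_string_f:
  assumes "weight_vec \<omega> u" and "f_stable N" and "\<And>w. w \<in> N \<Longrightarrow> act (e i) w \<in> N" and "act (e i) u \<in> N"
  shows "sl2_string sv (act (e i)) (act (f i)) (act (\<iota> (coroot i))) u (\<omega> (coroot i)) N"
proof unfold_locales
  show "act (e i) (act (f i) w) = act (f i) (act (e i) w) + act (\<iota> (coroot i)) w" for w
    by (simp add: act_commute[of "e i"] ef)
  show "act (\<iota> (coroot i)) ((act (f i) ^^ p) u)
      = sv (\<omega> (coroot i) - 2 * of_nat p) ((act (f i) ^^ p) u)" for p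
    using weight_vec_f_pow[OF assms(1), of p i] by (simp add: weight_vec_def sroot_self mult.commute)
qed (use assms in \<open>auto simp: f_stable_def act_r.add act_r.scale\<close>)

lemma sl2_string_e:
  assumes "weight_vec \<omega> u" and "f_stable N" and "\<And>w. w \<in> N \<Longrightarrow> act (e i) w \<in> N" and "act (f i) u \<in> N"
  shows "sl2_string sv (act (f i)) (act (e i)) (\<lambda>w. - act (\<iota> (coroot i)) w) u (- \<omega> (coroot i)) N"
proof unfold_locales
  show "act (f i) (act (e i) w) = act (e i) (act (f i) w) + - act (\<iota> (coroot i)) w" for w
    by (simp add: act_commute[of "e i"] ef)
  have "- act (\<iota> (coroot i)) ((act (e i) ^^ p) u)
      = - sv (\<omega> (coroot i) + 2 * of_nat p) ((act (e i) ^^ p) u)" for p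
    using weight_vec_e_pow[OF assms(1), of p i] by (simp add: weight_vec_def sroot_self mult.commute)
  then show "- act (\<iota> (coroot i)) ((act (e i) ^^ p) u)
      = sv (- \<omega> (coroot i) - 2 * of_nat p) ((act (e i) ^^ p) u)" for p
    by (simp add: v.scale_minus_left[symmetric] del: v.scale_minus_left)
qed (use assms in \<open>auto simp: f_stable_def act_r.add act_r.scale\<close>)

lemma weight_vec_unique: "weight_vec \<omega> u \<Longrightarrow> weight_vec \<nu> u \<Longrightarrow> u \<noteq> 0 \<Longrightarrow> \<omega> = \<nu>"
  unfolding weight_vec_def by (metis ext v.scale_right_imp_eq)

text \<open>The elements of the Lie algebra that preserve a subspace form a subalgebra.\<close>
lemma generators_suffice:
  assumes "v.subspace M" and "\<And>x u. u \<in> M \<Longrightarrow> act (\<iota> x) u \<in> M"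
    and "\<And>i u. u \<in> M \<Longrightarrow> act (e i) u \<in> M" and "\<And>i u. u \<in> M \<Longrightarrow> act (f i) u \<in> M"
    and "u \<in> M"
  shows "act x u \<in> M"
proof -
  let ?S = "{x. \<forall>u\<in>M. act x u \<in> M}"
  have "lie_subalgebra sg br ?S"
    using assms(1) unfolding lie_subalgebra_def subspace_def
    by (auto simp: act_l.zero act_l.add act_l.scale act_br v.subspace_0
        intro: v.subspace_add v.subspace_scale v.subspace_diff)
  moreover have "range \<iota> \<union> range e \<union> range f \<subseteq> ?S" using assms by auto
  ultimately have "lie_subalgebra sg br hull (range \<iota> \<union> range e \<union> range f) \<subseteq> ?S"
    by (rule hull_minimal[rotated])
  then show ?thesis using generated assms(5) by auto
qed

lemma word_span_invariant:
  assumes "maximal_vec (below sroot lam y) w" and "u \<in> v.span {lower_word l w | l. True}"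
  shows "act x u \<in> v.span {lower_word l w | l. True}"
proof (rule generators_suffice[OF v.subspace_span _ _ _ assms(2)])
  let ?M = "v.span {lower_word l w | l. True}"
  have w: "weight_vec (below sroot lam y) w" using assms(1) by (simp add: maximal_vec_def)
  show "act (\<iota> x) u \<in> ?M" if "u \<in> ?M" for x u
  proof (rule act_span[OF v.subspace_span _ that])
    fix s assume "s \<in> {lower_word l w | l. True}"
    then obtain l where "s = lower_word l w" by blast
    then show "act (\<iota> x) s \<in> ?M"
      using that v.span_base[of s "{lower_word l w | l. True}"] lower_word_weight_vec[OF w, of l]
      by (auto simp: weight_vec_def intro!: v.span_scale)
  qed
  show "act (e i) u \<in> ?M" if "u \<in> ?M" for i u
  proof (rule act_span[OF v.subspace_span _ that])
    fix s assume "s \<in> {lower_word l w | l. True}"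
    then obtain l where "s = lower_word l w" by blast
    moreover have "{lower_word l' w | l'. mset l = add_mset i (mset l')} \<subseteq> {lower_word l w | l. True}" by blast
    ultimately show "act (e i) s \<in> ?M" using raise_lower_word[OF assms(1), of i l] v.span_mono by blast
  qed
  show "act (f i) u \<in> ?M" if "u \<in> ?M" for i u
  proof (rule act_span[OF v.subspace_span _ that])
    fix s assume "s \<in> {lower_word l w | l. True}"
    then obtain l where "act (f i) s = lower_word (i # l) w" by auto
    then show "act (f i) s \<in> ?M" by (metis (mono_tags, lifting) mem_Collect_eq v.span_base)
  qed
qed

lemma e_f_pow_commute:
  assumes "k \<noteq> i"
  shows "act (e k) ((act (f i) ^^ p) u) = (act (f i) ^^ p) (act (e k) u)"
  using assms by (induction p) (simp_all add: act_commute[of "e k"] ef act_l.zero)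

lemma f_stable_zero: "f_stable {0}"
  by (simp add: f_stable_def v.subspace_def act_r.zero)

lemma sl2_string_f_zero:
  assumes "weight_vec \<omega> u" and "act (e i) u = 0"
  shows "sl2_string sv (act (e i)) (act (f i)) (act (\<iota> (coroot i))) u (\<omega> (coroot i)) {0}"
  by (rule sl2_string_f[OF assms(1) f_stable_zero]) (auto simp: assms act_r.zero)

lemma act_pow_zero: "(act x ^^ n) 0 = 0"
  by (induction n) (auto simp: act_r.zero)

lemma act_pow_add: "(act x ^^ n) (u + w) = (act x ^^ n) u + (act x ^^ n) w"
  by (induction n) (auto simp: act_r.add)

lemma act_pow_scale: "(act x ^^ n) (sv c u) = sv c ((act x ^^ n) u)"
  by (induction n) (auto simp: act_r.scale)

text \<open>For \<open>p = m\<close> the factor \<open>(p + 1) (m - p)\<close> in the commutation formula vanishes.\<close>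
lemma e_kills_singular:
  assumes "weight_vec \<omega> u" and "act (e i) u = 0" and "\<omega> (coroot i) = of_nat m"
  shows "act (e i) ((act (f i) ^^ Suc m) u) = 0"
proof -
  interpret sl2_string sv "act (e i)" "act (f i)" "act (\<iota> (coroot i))" u "\<omega> (coroot i)" "{0}"
    using assms by (intro sl2_string_f_zero)
  show ?thesis using e_f_power[of m] assms(2,3) by (simp add: act_r.zero act_pow_zero)
qed

end

section \<open>The Serre relations\<close>

context kac_moody_algebra
begin

sublocale br_r: Vector_Spaces.linear sg sg "br x" for x
  by (rule br_linear_right)

sublocale br_l: Vector_Spaces.linear sg sg "\<lambda>x. br x y" for y
  by (rule br_linear_left)

lemma br_anti: "br x y = - br y x"
proof -
  have "br (x + y) (x + y) = br x x + br y x + (br x y + br y y)"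
    by (simp only: br_r.add br_l.add)
  then have "br x y + br y x = 0" by (simp add: br_self add.commute)
  then show ?thesis by (simp add: eq_neg_iff_add_eq_0)
qed

lemma adjoint_module: "km_module A sh coroot sroot sg br \<iota> e f sg br"
proof unfold_locales
  show "br (br x y) v = br x (br y v) - br y (br x v)" for x y v
  proof -
    have "br (br x y) v = - br v (br x y)" by (rule br_anti)
    also have "\<dots> = br x (br y v) + br y (br v x)"
      using jacobi[of x y v] by (simp add: eq_neg_iff_add_eq_0 add.commute neg_eq_iff_add_eq_0 add.assoc)
    also have "br y (br v x) = - br y (br x v)" using br_anti[of v x] by (simp add: br_r.neg)
    finally show ?thesis by simp
  qed
qed

text \<open>
  The vector \<open>\<theta> = ad(f\<^sub>j)\<^sup>m\<^sup>+\<^sup>1 f\<^sub>i\<close>, where \<open>m = - A\<^sub>j\<^sub>i\<close>, is killed by all \<open>e\<^sub>k\<close>: by \<open>sl\<^sub>2\<close>-theory for \<open>k = j\<close>,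
  and otherwise because \<open>e\<^sub>k\<close> commutes with \<open>f\<^sub>j\<close>, which leaves \<open>ad(f\<^sub>j)\<^sup>m\<^sup>+\<^sup>1 [e\<^sub>k, f\<^sub>i] = 0\<close>.  So the ideal
  generated by \<open>\<theta>\<close> is spanned by lowering words applied to \<open>\<theta>\<close>, all of nonzero weight.  It therefore
  meets the Cartan subalgebra trivially and is zero.
\<close>
lemma serre:
  assumes "i \<noteq> j"
  shows "(br (f j) ^^ Suc (nat (- (A $ j $ i)))) (f i) = 0"
proof -
  interpret adj: km_module A sh coroot sroot sg br \<iota> e f sg br
    by (rule adjoint_module)
  have "A $ j $ i \<le> 0" using gcm assms unfolding gcm_def by metis
  then obtain m where m: "A $ j $ i = - int m" by (metis nonpos_int_cases)
  define \<theta> where "\<theta> = (br (f j) ^^ Suc m) (f i)"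
  define y where "y = add_mset i (replicate_mset (Suc m) j)"
  have fi: "adj.weight_vec (\<lambda>x. - sroot i x) (f i)"
    by (simp add: adj.weight_vec_def hf)
  have ej: "br (e j) (f i) = 0" using assms by (simp add: ef)
  \<comment> \<open>For \<open>k = i\<close> the vector \<open>[e\<^sub>i, f\<^sub>i]\<close> lies in the Cartan subalgebra and two applications of \<open>ad(f\<^sub>j)\<close> kill it; if \<open>m = 0\<close>, one does.\<close>
  have "br (e k) \<theta> = 0" for k
  proof (cases "k = j")
    case True
    have "- sroot i (coroot j) = of_nat m" by (simp add: pairing m)
    from adj.e_kills_singular[OF fi ej this] show ?thesis using True by (simp add: \<theta>_def)
  next
    case False
    have "br (e k) \<theta> = (br (f j) ^^ Suc m) (br (e k) (f i))"
      unfolding \<theta>_def by (rule adj.e_f_pow_commute[OF False])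
    also have "\<dots> = 0"
    proof (cases "k = i")
      case True
      have fh: "br (f j) (\<iota> (coroot i)) = sg (of_int (A $ i $ j)) (f j)"
        by (subst br_anti) (simp add: hf pairing)
      show ?thesis
      proof (cases m)
        case 0
        then have "A $ i $ j = 0" using m gcm unfolding gcm_def by (metis int_ops(1) neg_0_equal_iff_equal)
        then show ?thesis using True 0 fh by (simp add: ef)
      next
        case (Suc m')
        have "br (f j) (br (f j) (\<iota> (coroot i))) = 0"
          unfolding fh by (simp add: br_r.scale br_self)
        then show ?thesis using True Suc
          by (simp add: ef funpow_swap1 adj.act_pow_zero br_r.zero)
      qed
    qed (use assms in \<open>simp add: ef adj.act_pow_zero br_r.zero\<close>)
    finally show ?thesis .
  qed
  moreover have "below sroot (\<lambda>_. 0) y = (\<lambda>x. - sroot i x - of_nat (Suc m) * sroot j x)"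
    by (simp add: below_def y_def fun_eq_iff distrib_right)
  then have "adj.weight_vec (below sroot (\<lambda>_. 0) y) \<theta>"
    using adj.weight_vec_f_pow[OF fi, of "Suc m" j] unfolding \<theta>_def by simp
  ultimately have \<theta>: "adj.maximal_vec (below sroot (\<lambda>_. 0) y) \<theta>" by (simp add: adj.maximal_vec_def)
  let ?G = "{adj.lower_word l \<theta> | l. True}"
  have "lie_ideal sg br (span ?G)"
    using adj.word_span_invariant[OF \<theta>] by (simp add: lie_ideal_def)
  moreover have "span ?G \<inter> range \<iota> = {0}"
  proof -
    have "t = 0" if t: "t \<in> span ?G" "t \<in> range \<iota>" for t
    proof -
      have "adj.weight_vec (\<lambda>_. 0) t" using t(2) by (auto simp: adj.weight_vec_def cartan_comm)
      moreover have w: "adj.weight_vec (below sroot (\<lambda>_. 0) y) \<theta>" using \<theta> by (simp add: adj.maximal_vec_def)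
      ultimately have "t \<in> span {g \<in> ?G. adj.weight_vec (\<lambda>_. 0) g}"
        using adj.weight_component[of "\<lambda>_. 0" t ?G] t(1) adj.lower_word_weight_vec[OF w] by blast
      moreover have "g = 0" if "g \<in> ?G" "adj.weight_vec (\<lambda>_. 0) g" for g
      proof (rule ccontr)
        assume "g \<noteq> 0"
        obtain l where "g = adj.lower_word l \<theta>" using \<open>g \<in> ?G\<close> by blast
        then have "below sroot (\<lambda>_. 0) (mset l + y) = below sroot (\<lambda>_. 0) {#}"
          using adj.weight_vec_unique[OF adj.lower_word_weight_vec[OF w, of l]] that(2) \<open>g \<noteq> 0\<close> by simp
        then show False by (simp add: below_eq_iff y_def del: below_empty)
      qed
      then have "{g \<in> ?G. adj.weight_vec (\<lambda>_. 0) g} \<subseteq> {0}" by blast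
      ultimately have "t \<in> span {0}" using span_mono by blast
      then show ?thesis by simp
    qed
    moreover have "0 \<in> range \<iota>"
    proof -
      interpret I: Vector_Spaces.linear sh sg \<iota> by (rule cartan_linear)
      show ?thesis using I.zero by (metis rangeI)
    qed
    ultimately show ?thesis using span_zero by blast
  qed
  ultimately have "span ?G = {0}" by (rule no_ideals)
  moreover have "\<theta> \<in> span ?G" using adj.lower_word_simps(1)[of \<theta>] by (metis (mono_tags, lifting) mem_Collect_eq span_base)
  ultimately have "\<theta> = 0" by simp
  then show ?thesis by (simp add: \<theta>_def m)
qed

end

section \<open>Transfer of annihilators\<close>

context km_module
begin

lemma f_commute:
  assumes "A $ j $ i = 0"
  shows "act (f j) (act (f i) u) = act (f i) (act (f j) u)"
proof -
  have "i \<noteq> j" using assms gcm unfolding gcm_def by force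
  from serre[OF this] assms have "br (f j) (f i) = 0" by simp
  then show ?thesis by (simp add: act_commute[of "f j"] act_l.zero)
qed

text \<open>
  By the Leibniz rule \<open>y (x w) = x (y w) + [y, x] w\<close>, the \<open>n + K\<close> factors \<open>y\<close> are distributed over \<open>x\<close> and
  \<open>w\<close>: either \<open>x\<close> receives at least \<open>K\<close> of them, which gives zero, or \<open>w\<close> receives at least \<open>n\<close>, which
  gives a vector of \<open>N\<close>.
\<close>
lemma leibniz_nilpotent:
  assumes "v.subspace N" and "\<And>u. u \<in> N \<Longrightarrow> act y u \<in> N" and "\<And>u. u \<in> N \<Longrightarrow> act x u \<in> N"
    and "(br y ^^ K) x = 0" and "(act y ^^ n) w \<in> N"
  shows "(act y ^^ (n + K)) (act x w) \<in> N"
  using assms(3-5)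
proof (induction "n + K" arbitrary: n K x w)
  case 0
  then show ?case by (simp add: act_l.zero assms(1) v.subspace_0)
next
  case (Suc s)
  have pow: "(act y ^^ p) u \<in> N" if "u \<in> N" for p u
    using that by (induction p) (auto intro: assms(2))
  show ?case
  proof (cases K)
    case 0
    then show ?thesis using Suc.prems(2) by (simp add: act_l.zero act_pow_zero assms(1) v.subspace_0)
  next
    case K: (Suc K')
    show ?thesis
    proof (cases n)
      case 0
      then show ?thesis using Suc.prems pow by simp
    next
      case n: (Suc n')
      have "(act y ^^ s) (act x (act y w)) \<in> N"
        using Suc.hyps(1)[of n' K x "act y w"] Suc.hyps(2) Suc.prems n by (simp add: funpow_swap1)
      moreover have "(act y ^^ s) (act (br y x) w) \<in> N"
        using Suc.hyps(1)[of n K' "br y x" w] Suc.hyps(2) Suc.prems K assms(1,2)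
        by (simp add: funpow_swap1 act_br v.subspace_diff)
      ultimately have "(act y ^^ s) (act y (act x w)) \<in> N"
        by (simp add: act_commute[of y] act_pow_add v.subspace_add[OF assms(1)])
      then show ?thesis using Suc.hyps(2)[symmetric] by (simp add: funpow_swap1)
    qed
  qed
qed

definition power_preimage :: "'i \<Rightarrow> 'v set \<Rightarrow> 'v set" where
  "power_preimage j N = {w. \<exists>n. (act (f j) ^^ n) w \<in> N}"

text \<open>Here the Serre relations enter: \<open>ad(f\<^sub>j)\<close> is nilpotent on each \<open>f\<^sub>i\<close>.\<close>
lemma f_stable_power_preimage:
  assumes "f_stable N"
  shows "f_stable (power_preimage j N)"
proof -
  have sub: "v.subspace N" and f: "\<And>i u. u \<in> N \<Longrightarrow> act (f i) u \<in> N"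
    using assms by (auto simp: f_stable_def)
  have pow: "(act (f j) ^^ p) u \<in> N" if "u \<in> N" for p u
    using that by (induction p) (auto intro: f)
  have "v.subspace (power_preimage j N)"
    unfolding v.subspace_def
  proof (intro conjI ballI allI)
    show "0 \<in> power_preimage j N" using sub by (auto simp: power_preimage_def act_pow_zero v.subspace_0)
    show "sv c u \<in> power_preimage j N" if "u \<in> power_preimage j N" for c u
      using that sub by (auto simp: power_preimage_def act_pow_scale intro: v.subspace_scale)
    show "u + w \<in> power_preimage j N" if "u \<in> power_preimage j N" "w \<in> power_preimage j N" for u w
    proof -
      obtain n m where nm: "(act (f j) ^^ n) u \<in> N" "(act (f j) ^^ m) w \<in> N"
        using \<open>u \<in> power_preimage j N\<close> \<open>w \<in> power_preimage j N\<close> by (auto simp: power_preimage_def)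
      have "(act (f j) ^^ (m + n)) u \<in> N" "(act (f j) ^^ (n + m)) w \<in> N"
        using pow[OF nm(1), of m] pow[OF nm(2), of n] by (simp_all add: funpow_add)
      then have "(act (f j) ^^ (n + m)) (u + w) \<in> N"
        using sub by (simp add: act_pow_add add.commute v.subspace_add)
      then show ?thesis by (auto simp: power_preimage_def)
    qed
  qed
  moreover have "act (f i) w \<in> power_preimage j N" if "w \<in> power_preimage j N" for i w
  proof -
    have "\<exists>K. (br (f j) ^^ K) (f i) = 0"
    proof (cases "i = j")
      case True
      then have "(br (f j) ^^ 1) (f i) = 0" by (simp add: br_self)
      then show ?thesis by blast
    qed (use serre in blast)
    then show ?thesis using leibniz_nilpotent[OF sub f f] that unfolding power_preimage_def by blast
  qed
  ultimately show ?thesis by (simp add: f_stable_def)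
qed

text \<open>
  If some word in certain letters sends \<open>w\<close> into \<open>N\<close>, then some word in the same letters does so for
  any vector reached from \<open>w\<close> by lowering.  Contrapositively, if no word in these letters annihilates
  a vector below \<open>w\<close>, then none annihilates \<open>w\<close>.
\<close>
lemma annihilator_transfer:
  assumes "f_stable N" and "lower_word l w \<in> N"
  shows "\<exists>l'. set l' \<subseteq> set l \<and> lower_word l' (lower_word k w) \<in> N"
  using assms
proof (induction l arbitrary: N)
  case Nil
  then show ?case using lower_word_f_stable[OF Nil(1)] by (intro exI[of _ "[]"]) simp
next
  case (Cons j l)
  have "(act (f j) ^^ 1) (lower_word l w) \<in> N" using Cons.prems by simp
  then have "lower_word l w \<in> power_preimage j N" unfolding power_preimage_def by blast
  from Cons.IH[OF f_stable_power_preimage[OF Cons.prems(1)] this]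
  obtain l' n where "set l' \<subseteq> set l" "(act (f j) ^^ n) (lower_word l' (lower_word k w)) \<in> N"
    by (auto simp: power_preimage_def)
  then show ?case
    by (intro exI[of _ "replicate n j @ l'"]) (auto simp: lower_word_replicate)
qed

lemma maximal_vec_f_pow:
  assumes w: "maximal_vec (below sroot lam y) w" and lab: "below sroot lam y (coroot i) = of_nat m"
  shows "maximal_vec (below sroot lam (replicate_mset (Suc m) i + y)) ((act (f i) ^^ Suc m) w)"
proof -
  have wv: "weight_vec (below sroot lam y) w" and ew: "\<And>k. act (e k) w = 0"
    using w by (auto simp: maximal_vec_def)
  have "act (e k) ((act (f i) ^^ Suc m) w) = 0" for k
  proof (cases "k = i")
    case True
    then show ?thesis using e_kills_singular[OF wv ew lab] by simp
  next
    case False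
    from e_f_pow_commute[OF this, of "Suc m" w] show ?thesis by (simp only: ew act_pow_zero)
  qed
  moreover have "weight_vec (below sroot lam (replicate_mset (Suc m) i + y)) ((act (f i) ^^ Suc m) w)"
    using lower_word_weight_vec[OF wv, of "replicate (Suc m) i"] by (simp only: lower_word_replicate mset_replicate)
  ultimately show ?thesis by (simp add: maximal_vec_def)
qed

end

section \<open>Free nodes and climbing along integrable directions\<close>

text \<open>
  The functional \<open>lam\<close> only fixes the origin of degrees: the maximal vectors considered below have
  weights \<open>lam - \<Sum>\<^sub>j\<^sub>\<in>\<^sub>y \<alpha>\<^sub>j\<close>, which may fail to be dominant.
\<close>
locale dominant_km_module = km_module A sh coroot sroot sg br \<iota> e f sv act
  for A :: "int ^ 'i::finite ^ 'i" and sh :: "complex \<Rightarrow> 'h::ab_group_add \<Rightarrow> 'h"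
    and coroot :: "'i \<Rightarrow> 'h" and sroot :: "'i \<Rightarrow> 'h \<Rightarrow> complex"
    and sg :: "complex \<Rightarrow> 'g::ab_group_add \<Rightarrow> 'g" and br :: "'g \<Rightarrow> 'g \<Rightarrow> 'g"
    and \<iota> :: "'h \<Rightarrow> 'g" and e f :: "'i \<Rightarrow> 'g"
    and sv :: "complex \<Rightarrow> 'v::ab_group_add \<Rightarrow> 'v" and act :: "'g \<Rightarrow> 'v \<Rightarrow> 'v" +
  fixes lam :: "'h \<Rightarrow> complex" and a :: "'i \<Rightarrow> nat"
  assumes lam_coroot: "lam (coroot i) = of_nat (a i)"
begin

abbreviation wgt :: "'i multiset \<Rightarrow> 'h \<Rightarrow> complex" where
  "wgt \<equiv> below sroot lam"

abbreviation lab :: "'i \<Rightarrow> 'i multiset \<Rightarrow> int" where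
  "lab \<equiv> label A a"

lemma wgt_coroot: "wgt x (coroot i) = of_int (lab i x)"
  by (rule below_coroot) (rule lam_coroot)

lemma diag: "A $ i $ i = 2"
  using gcm by (simp add: gcm_def)

lemma offdiag: "i \<noteq> j \<Longrightarrow> A $ i $ j \<le> 0"
  using gcm unfolding gcm_def by metis

definition singular :: "'i multiset \<Rightarrow> 'i \<Rightarrow> 'v \<Rightarrow> 'v" where
  "singular y i w = (act (f i) ^^ Suc (nat (lab i y))) w"

definition singular_degree :: "'i multiset \<Rightarrow> 'i \<Rightarrow> 'i multiset" where
  "singular_degree y i = replicate_mset (Suc (nat (lab i y))) i"

lemma maximal_vec_singular:
  assumes "maximal_vec (wgt y) w" and "0 \<le> lab i y"
  shows "maximal_vec (wgt (singular_degree y i + y)) (singular y i w)"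
proof -
  have "wgt y (coroot i) = of_nat (nat (lab i y))"
    using assms(2) by (simp add: wgt_coroot)
  from maximal_vec_f_pow[OF assms(1) this] show ?thesis
    by (simp only: singular_def singular_degree_def)
qed

text \<open>Modulo the submodule spanned by these words, the module generated by \<open>w\<close> becomes integrable along \<open>D\<close>.\<close>
definition singular_words :: "'i set \<Rightarrow> 'i multiset \<Rightarrow> 'v \<Rightarrow> 'v set" where
  "singular_words D y w = {lower_word l (singular y i w) | l i. i \<in> D}"

lemma f_stable_singular_words: "f_stable (v.span (singular_words D y w))"
proof -
  have "act (f k) u \<in> v.span (singular_words D y w)" if "u \<in> v.span (singular_words D y w)" for k u
  proof (rule act_span[OF v.subspace_span _ that])
    fix s assume "s \<in> singular_words D y w"
    then obtain l i where "i \<in> D" "act (f k) s = lower_word (k # l) (singular y i w)"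
      by (auto simp: singular_words_def)
    then have "act (f k) s \<in> singular_words D y w" unfolding singular_words_def by blast
    then show "act (f k) s \<in> v.span (singular_words D y w)" by (rule v.span_base)
  qed
  then show ?thesis by (simp add: f_stable_def)
qed

lemma e_singular_words:
  assumes w: "maximal_vec (wgt y) w" and D: "\<And>i. i \<in> D \<Longrightarrow> 0 \<le> lab i y"
    and u: "u \<in> v.span (singular_words D y w)"
  shows "act (e k) u \<in> v.span (singular_words D y w)"
proof (rule act_span[OF v.subspace_span _ u])
  fix s assume "s \<in> singular_words D y w"
  then obtain l i where s: "i \<in> D" "s = lower_word l (singular y i w)" by (auto simp: singular_words_def)
  have "{lower_word l' (singular y i w) | l'. mset l = add_mset k (mset l')} \<subseteq> singular_words D y w"
    using s(1) unfolding singular_words_def by blast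
  then show "act (e k) s \<in> v.span (singular_words D y w)"
    using raise_lower_word[OF maximal_vec_singular[OF w D[OF s(1)]], of k l] v.span_mono s(2) by blast
qed

text \<open>
  In the quotient by the singular vectors \<open>f\<^sub>i\<^sup>m\<^sup>+\<^sup>1 w\<close>, \<open>i \<in> D\<close>, the \<open>f\<^sub>i\<close> with \<open>i \<in> D\<close> act locally nilpotently.
  So the weight of a surviving word climbs along \<open>D\<close> until only the letters outside \<open>D\<close> are left.
  Consider the leftmost letter \<open>i\<close>.  If \<open>i \<notin> D\<close>, the climb of the shorter word can be shifted by
  \<open>\<alpha>\<^sub>i\<close>.  If \<open>i \<in> D\<close>, either the weight \<open>\<nu>\<close> of the word satisfies \<open>\<langle>\<nu>, \<alpha>\<^sub>i\<^sup>\<or>\<rangle> \<ge> -1\<close>, and removing this letter is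
  a step; or, by local nilpotency, the reflected weight \<open>s\<^sub>i \<nu>\<close> is higher and also occurs.
\<close>
lemma climbs_in_integrable_quotient:
  assumes w: "maximal_vec (wgt y) w" and D: "\<And>i. i \<in> D \<Longrightarrow> 0 \<le> lab i y"
    and "lower_word l w \<notin> v.span (singular_words D y w)"
  shows "climbs A a D (mset l + y) (filter_mset (\<lambda>i. i \<notin> D) (mset l) + y)"
  using assms(3)
proof (induction "length l" arbitrary: l rule: less_induct)
  case less
  let ?N = "v.span (singular_words D y w)"
  let ?top = "\<lambda>l. filter_mset (\<lambda>i. i \<notin> D) (mset l) + y"
  have wv: "weight_vec (wgt y) w" using w by (simp add: maximal_vec_def)
  have fN: "u \<in> ?N \<Longrightarrow> act (f i) u \<in> ?N" for i u
    using f_stable_singular_words by (simp add: f_stable_def)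
  show ?case
  proof (cases l)
    case Nil
    then show ?thesis by (simp add: climbs.refl)
  next
    case (Cons i l')
    have l': "lower_word l' w \<notin> ?N" using less.prems fN Cons by auto
    have IH: "climbs A a D (mset l' + y) (?top l')" using less.hyps[OF _ l'] Cons by simp
    show ?thesis
    proof (cases "i \<in> D")
      case False
      then show ?thesis using climbs_shift[OF gcm IH] Cons by simp
    next
      case iD: True
      show ?thesis
      proof (cases "- 1 \<le> lab i (mset l + y)")
        case True
        have "climbs A a D ((mset l' + y) + replicate_mset 1 i) (?top l')"
          using True Cons by (intro climbs.step[OF IH iD]) (auto simp: label_def diag)
        then show ?thesis using Cons iD by simp
      next
        case False
        define m where "m = nat (- lab i (mset l + y))"
        have m: "lab i (mset l + y) = - int m" "0 < m" using False by (auto simp: m_def)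
        have "(act (f i) ^^ Suc (nat (lab i y))) w \<in> ?N"
          using iD by (intro v.span_base) (auto simp: singular_words_def singular_def intro!: exI[of _ "[]"])
        then have "w \<in> power_preimage i ?N" unfolding power_preimage_def by blast
        \<comment> \<open>Local nilpotency of \<open>f\<^sub>i\<close> modulo \<open>N\<close> passes from \<open>w\<close> to all words.\<close>
        then have "lower_word l w \<in> power_preimage i ?N"
          using lower_word_f_stable[OF f_stable_power_preimage[OF f_stable_singular_words]] by blast
        then have ex: "\<exists>q. (act (f i) ^^ q) (lower_word l w) \<in> ?N" by (simp add: power_preimage_def)
        define q where "q = (LEAST q. (act (f i) ^^ q) (lower_word l w) \<in> ?N)"
        have q: "(act (f i) ^^ q) (lower_word l w) \<in> ?N" unfolding q_def using LeastI_ex[OF ex] .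
        have "q \<noteq> 0" using q less.prems by (cases q) auto
        then obtain p where p: "q = Suc p" by (cases q) auto
        \<comment> \<open>The lower end of the string through the word; from here \<open>e\<^sub>i\<close> can be applied \<open>m + 2 p\<close> times.\<close>
        let ?z = "lower_word (replicate p i @ l) w"
        have z: "?z = (act (f i) ^^ p) (lower_word l w)" by (simp add: lower_word_replicate)
        have zN: "?z \<notin> ?N"
          unfolding z using not_less_Least[of p "\<lambda>q. (act (f i) ^^ q) (lower_word l w) \<in> ?N"] p
          by (simp add: q_def)
        have fzN: "act (f i) ?z \<in> ?N" unfolding z using q p by simp
        let ?x = "mset (replicate p i @ l) + y"
        interpret sl2_string sv "act (f i)" "act (e i)" "\<lambda>w. - act (\<iota> (coroot i)) w" ?z
          "- wgt ?x (coroot i)" ?N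
          by (rule sl2_string_e[OF lower_word_weight_vec[OF wv] f_stable_singular_words e_singular_words[OF w D] fzN])
        have "lab i ?x = lab i (mset l + y) - 2 * int p"
          by (simp add: label_def diag)
        then have lab: "lab i ?x = - int (m + 2 * p)" using m(1) by linarith
        have "- wgt ?x (coroot i) = of_nat (m + 2 * p)"
          unfolding wgt_coroot lab by simp
        then have "(act (e i) ^^ (m + p)) ?z \<notin> ?N"
          using zN by (intro string_survives[of "m + 2 * p"]) auto
        moreover have "(act (e i) ^^ (m + p)) ?z
            \<in> v.span {lower_word l'' w | l''. mset (replicate p i @ l) = replicate_mset (m + p) i + mset l''}"
          by (rule raise_pow_lower_word[OF w])
        ultimately have "\<not> {lower_word l'' w | l''. mset (replicate p i @ l) = replicate_mset (m + p) i + mset l''} \<subseteq> ?N"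
          using v.span_minimal[OF _ v.subspace_span] by blast
        then obtain l'' where l'': "replicate_mset p i + mset l = replicate_mset (m + p) i + mset l''"
          "lower_word l'' w \<notin> ?N" by auto
        have ml: "mset l = mset l'' + replicate_mset m i"
          using l''(1) by (intro multiset_eqI) (auto simp: multiset_eq_iff split: if_splits)
        then have "length l = length l'' + m" by (metis size_mset size_replicate_mset size_union)
        then have "climbs A a D (mset l'' + y) (?top l'')" using less.hyps[OF _ l''(2)] m(2) by simp
        moreover have "int m \<le> lab i (mset l'' + y)"
          using m ml by (simp add: label_def diag)
        ultimately have "climbs A a D ((mset l'' + y) + replicate_mset m i) (?top l'')"
          using climbs.step iD m(2) by blast
        moreover have "?top l = ?top l''"
          by (rule multiset_eqI) (use iD in \<open>simp add: ml\<close>)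
        moreover have "mset l + y = (mset l'' + y) + replicate_mset m i" by (simp add: ml)
        ultimately show ?thesis by (simp only:)
      qed
    qed
  qed
qed

lemma lower_word_f_pow_commute:
  assumes "\<And>j. j \<in> set l \<Longrightarrow> A $ i $ j = 0"
  shows "lower_word l ((act (f i) ^^ n) u) = (act (f i) ^^ n) (lower_word l u)"
proof -
  have one: "lower_word l (act (f i) u) = act (f i) (lower_word l u)" for u
    using assms by (induction l) (auto simp: f_commute)
  show ?thesis by (induction n) (auto simp: one)
qed

lemma lower_word_extract_letter:
  assumes "\<And>j. j \<in> set l \<Longrightarrow> j \<noteq> i \<Longrightarrow> A $ i $ j = 0"
  shows "lower_word l u = (act (f i) ^^ count (mset l) i) (lower_word (filter (\<lambda>j. j \<noteq> i) l) u)"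
  using assms
proof (induction l)
  case (Cons k l)
  have *: "lower_word l u = (act (f i) ^^ count (mset l) i) (lower_word (filter (\<lambda>j. j \<noteq> i) l) u)"
    using Cons by simp
  show ?case
  proof (cases "k = i")
    case True
    then show ?thesis using * by simp
  next
    case False
    then have "A $ i $ k = 0" using Cons.prems by simp
    then have "lower_word [k] ((act (f i) ^^ n) t) = (act (f i) ^^ n) (lower_word [k] t)" for n t
      by (intro lower_word_f_pow_commute) simp
    then show ?thesis using * False by simp
  qed
qed simp

text \<open>
  The heart of the proof, by induction on \<open>D\<close>.  If the word survives modulo the singular vectors
  \<open>w\<^sub>i = f\<^sub>i\<^sup>m\<^sup>+\<^sup>1 w\<close>, \<open>i \<in> D\<close>, take \<open>J = D\<close>.  Otherwise its weight occurs in the submodule generated by one of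
  the \<open>w\<^sub>i\<close>, and the induction hypothesis for \<open>w\<^sub>i\<close> and \<open>D - {i}\<close> provides \<open>J\<close>; labels at the nodes other
  than \<open>i\<close> have only grown.  The climb is literally the same, since \<open>i \<notin> J\<close>.  That words in
  independent letters outside \<open>J\<close> do not annihilate \<open>w\<close> follows from the same for \<open>w\<^sub>i\<close>: for
  words without \<open>i\<close> by transfer of annihilators, and for words with \<open>i\<close> because \<open>f\<^sub>i\<close> commutes with
  the other letters and a string that survives its singular vector is infinite.
\<close>
lemma free_nodes_and_climb:
  assumes "finite D" and "maximal_vec (wgt y) w" and "\<And>i. i \<in> D \<Longrightarrow> 0 \<le> lab i y" and "lower_word l w \<noteq> 0"
  shows "\<exists>J\<subseteq>D. (\<forall>l'. set l' \<subseteq> D - J \<longrightarrow> independent_nodes A (set l') \<longrightarrow> lower_word l' w \<noteq> 0) \<and>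
    climbs A a J (mset l + y) (filter_mset (\<lambda>i. i \<notin> J) (mset l) + y)"
  using assms
proof (induction D arbitrary: y w l rule: finite_psubset_induct)
  case (psubset D)
  note w = psubset.prems(1) and D = psubset.prems(2)
  have wv: "weight_vec (wgt y) w" and ew: "\<And>i. act (e i) w = 0" using w by (auto simp: maximal_vec_def)
  have w0: "w \<noteq> 0" using psubset.prems(3) by auto
  show ?case
  proof (cases "lower_word l w \<in> v.span (singular_words D y w)")
    case False
    from climbs_in_integrable_quotient[OF w D this] w0 show ?thesis
      by (intro exI[of _ D]) auto
  next
    case True
    let ?G = "{g \<in> singular_words D y w. weight_vec (wgt (mset l + y)) g}"
    have deg: "weight_vec (wgt (mset l' + (singular_degree y i + y))) (lower_word l' (singular y i w))"
      if "i \<in> D" for l' i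
      using lower_word_weight_vec maximal_vec_singular[OF w D[OF that]] by (simp add: maximal_vec_def)
    \<comment> \<open>Weight spaces being independent, one of the generating words has the weight of \<open>lower_word l w\<close>.\<close>
    have "lower_word l w \<in> v.span ?G"
      by (rule weight_component[OF lower_word_weight_vec[OF wv] True]) (use deg in \<open>auto simp: singular_words_def\<close>)
    then have "\<not> ?G \<subseteq> {0}" using psubset.prems(3) v.span_mono[of ?G "{0}"] by auto
    then obtain g where g: "g \<in> ?G" "g \<noteq> 0" by blast
    then obtain l' i where i: "i \<in> D" "g = lower_word l' (singular y i w)"
      by (auto simp: singular_words_def)
    let ?n = "Suc (nat (lab i y))"
    have "wgt (mset l + y) = wgt (mset l' + (singular_degree y i + y))"
      using g deg[OF i(1), of l'] i(2) by (intro weight_vec_unique[of _ g]) auto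
    then have ml: "mset l = mset l' + singular_degree y i"
      by (simp add: below_eq_iff add.assoc[symmetric])
    have "0 \<le> lab j (singular_degree y i + y)" if "j \<in> D - {i}" for j
    proof -
      have "int (nat (lab i y)) * A $ j $ i \<le> 0" "A $ j $ i \<le> 0"
        using offdiag[of j i] that by (auto simp: mult_nonneg_nonpos)
      then show ?thesis
        using D[of j] that by (simp add: label_def singular_degree_def)
    qed
    moreover have "D - {i} \<subset> D" using i(1) by blast
    ultimately obtain J where J: "J \<subseteq> D - {i}"
      and free: "\<And>l0. set l0 \<subseteq> D - {i} - J \<Longrightarrow> independent_nodes A (set l0) \<Longrightarrow> lower_word l0 (singular y i w) \<noteq> 0"
      and climb: "climbs A a J (mset l' + (singular_degree y i + y))
        (filter_mset (\<lambda>i. i \<notin> J) (mset l') + (singular_degree y i + y))"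
      using psubset.IH[of "D - {i}" "singular_degree y i + y" "singular y i w" l']
        maximal_vec_singular[OF w D[OF i(1)]] i(2) g(2) by blast
    have "filter_mset (\<lambda>i. i \<notin> J) (singular_degree y i) = singular_degree y i"
      using J by (auto simp: singular_degree_def filter_mset_eq_conv)
    then have "climbs A a J (mset l + y) (filter_mset (\<lambda>i. i \<notin> J) (mset l) + y)"
      using climb by (simp add: ml add.assoc)
    moreover have "lower_word l0 w \<noteq> 0" if l0: "set l0 \<subseteq> D - J" "independent_nodes A (set l0)" for l0
    proof (cases "i \<in> set l0")
      case False
      show ?thesis
      proof
        assume "lower_word l0 w = 0"
        then obtain l1 where "set l1 \<subseteq> set l0" "lower_word l1 (lower_word (replicate ?n i) w) = 0"
          using annihilator_transfer[OF f_stable_zero, of l0 w "replicate ?n i"] by auto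
        moreover have "lower_word (replicate ?n i) w = singular y i w"
          by (simp only: lower_word_replicate singular_def)
        moreover have "independent_nodes A (set l1)"
          using l0(2) \<open>set l1 \<subseteq> set l0\<close> by (auto simp: independent_nodes_def)
        ultimately show False using free[of l1] l0(1) False by auto
      qed
    next
      case True
      have orth: "A $ i $ j = 0" if "j \<in> set l0" "j \<noteq> i" for j
        using l0(2) True that by (auto simp: independent_nodes_def dynkin_edge_def)
      let ?l1 = "filter (\<lambda>j. j \<noteq> i) l0"
      have "(act (f i) ^^ ?n) (lower_word ?l1 w) = lower_word ?l1 (singular y i w)"
        unfolding singular_def by (rule lower_word_f_pow_commute[symmetric]) (use orth in auto)
      moreover have "independent_nodes A (set ?l1)"
        using l0(2) by (auto simp: independent_nodes_def)
      ultimately have nz: "(act (f i) ^^ ?n) (lower_word ?l1 w) \<noteq> 0"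
        using free[of ?l1] l0(1) by auto
      have "{lower_word l' w | l'. mset ?l1 = add_mset i (mset l')} = {}"
        by (auto dest: arg_cong[where f = "\<lambda>M. count M i"])
      then have e0: "act (e i) (lower_word ?l1 w) = 0" using raise_lower_word[OF w, of i ?l1] by simp
      have "(\<Sum>j\<in>#mset ?l1. A $ i $ j) = 0"
        using orth by (intro sum_mset.neutral) auto
      then have "lab i (mset ?l1 + y) = lab i y" by (simp add: add.commute)
      then have wt_i: "wgt (mset ?l1 + y) (coroot i) = of_nat (nat (lab i y))"
        using D[OF i(1)] by (simp add: wgt_coroot)
      interpret sl2_string sv "act (e i)" "act (f i)" "act (\<iota> (coroot i))" "lower_word ?l1 w"
        "wgt (mset ?l1 + y) (coroot i)" "{0}"
        by (rule sl2_string_f_zero[OF lower_word_weight_vec[OF wv] e0])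
      have "(act (f i) ^^ count (mset l0) i) (lower_word ?l1 w) \<notin> {0}"
        by (rule free_beyond_singular[OF _ wt_i]) (use nz in blast)
      then show ?thesis using lower_word_extract_letter[of l0 i w] orth by simp
    qed
    ultimately show ?thesis using J by blast
  qed
qed

section \<open>Weights of a highest weight module\<close>

text \<open>
  Going up along \<open>\<alpha>\<^sub>i\<close> from a weight of the module ends at a vector killed by \<open>e\<^sub>i\<close>, since \<open>e\<^sub>i\<close> is locally
  nilpotent; its string going down is long enough to contain the whole interval \<open>[s\<^sub>i \<nu>, \<nu>]\<close>.
\<close>
lemma weight_string:
  assumes w: "maximal_vec (wgt {#}) w" and gen: "v.span {lower_word l w | l. True} = UNIV"
    and lam: "lam \<in> dual_space sh"
    and y: "wgt y \<in> wt sh \<iota> sv act" and k: "int k \<le> lab i y"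
  shows "wgt (y + replicate_mset k i) \<in> wt sh \<iota> sv act"
proof -
  have wv: "weight_vec (wgt {#}) w" using w by (simp add: maximal_vec_def)
  obtain u where u: "u \<noteq> 0" "weight_vec (wgt y) u" using y by (auto simp: wt_def weight_vec_def)
  let ?G = "{g \<in> {lower_word l w | l. True}. weight_vec (wgt y) g}"
  let ?n = "Suc (size y)"
  have "u \<in> v.span ?G"
    by (rule weight_component[OF u(2)]) (use gen lower_word_weight_vec[OF wv] in auto)
  moreover have "?G \<subseteq> {u. (act (e i) ^^ ?n) u = 0}"
  proof
    fix g assume "g \<in> ?G"
    then obtain l where g: "g = lower_word l w" "weight_vec (wgt y) g" by blast
    show "g \<in> {u. (act (e i) ^^ ?n) u = 0}"
    proof (cases "g = 0")
      case True
      then show ?thesis using act_pow_zero[where x = "e i" and n = ?n] by blast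
    next
      case False
      then have "wgt (mset l) = wgt y"
        using weight_vec_unique[OF lower_word_weight_vec[OF wv, of l], of "wgt y"] g by simp
      then have "mset l = y" by (simp add: below_eq_iff)
      have "{lower_word l' w | l'. mset l = replicate_mset ?n i + mset l'} = {}"
        using \<open>mset l = y\<close> by (auto dest: arg_cong[where f = size])
      then have "(act (e i) ^^ ?n) (lower_word l w) \<in> v.span {}"
        using raise_pow_lower_word[OF w, where i = i and m = ?n and l = l] by (simp only:)
      then show ?thesis using g(1) by simp
    qed
  qed
  moreover have "v.subspace {u. (act (e i) ^^ ?n) u = 0}"
    unfolding v.subspace_def mem_Collect_eq act_pow_zero act_pow_add act_pow_scale by auto
  ultimately have "(act (e i) ^^ ?n) u = 0" using v.span_minimal by blast
  then have ex: "\<exists>n. (act (e i) ^^ n) u = 0" by blast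
  define q where "q = (LEAST n. (act (e i) ^^ n) u = 0)"
  have q: "(act (e i) ^^ q) u = 0" unfolding q_def using LeastI_ex[OF ex] .
  then obtain p where p: "q = Suc p" using u(1) by (cases q) auto
  \<comment> \<open>The upper end of the string through \<open>u\<close>.\<close>
  let ?z = "(act (e i) ^^ p) u"
  have z0: "?z \<noteq> 0" using not_less_Least[of p "\<lambda>n. (act (e i) ^^ n) u = 0"] p by (simp add: q_def)
  have ez: "act (e i) ?z = 0" using q p by simp
  have wz: "weight_vec (\<lambda>x. wgt y x + of_nat p * sroot i x) ?z" by (rule weight_vec_e_pow[OF u(2)])
  interpret sl2_string sv "act (e i)" "act (f i)" "act (\<iota> (coroot i))" ?z
    "wgt y (coroot i) + of_nat p * sroot i (coroot i)" "{0}"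
    by (rule sl2_string_f_zero[OF wz ez])
  define m where "m = nat (lab i y)"
  have m: "lab i y = int m" using k by (simp add: m_def)
  have "wgt y (coroot i) + of_nat p * sroot i (coroot i) = of_nat (m + 2 * p)"
    by (simp add: wgt_coroot m sroot_self)
  then have "(act (f i) ^^ (k + p)) ?z \<notin> {0}"
    using z0 k m by (intro string_survives[of "m + 2 * p"]) auto
  moreover have "(\<lambda>x. wgt y x + of_nat p * sroot i x - of_nat (k + p) * sroot i x)
      = wgt (y + replicate_mset k i)"
    by (simp add: fun_eq_iff below_def algebra_simps)
  then have "weight_vec (wgt (y + replicate_mset k i)) ((act (f i) ^^ (k + p)) ?z)"
    using weight_vec_f_pow[OF wz, of "k + p" i] by simp
  ultimately show ?thesis
    using below_dual[OF lam] unfolding wt_def weight_vec_def by blast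
qed

lemma climbs_weight:
  assumes "maximal_vec (wgt {#}) w" and "v.span {lower_word l w | l. True} = UNIV" and "lam \<in> dual_space sh"
  shows "climbs A a J x z \<Longrightarrow> wgt z \<in> wt sh \<iota> sv act \<Longrightarrow> wgt x \<in> wt sh \<iota> sv act"
  by (induction rule: climbs.induct) (auto intro: weight_string[OF assms])

lemma weight_is_word:
  assumes w: "maximal_vec (wgt {#}) w" and gen: "v.span {lower_word l w | l. True} = UNIV"
    and \<mu>: "\<mu> \<in> wt sh \<iota> sv act"
  obtains l where "lower_word l w \<noteq> 0" and "\<mu> = wgt (mset l)"
proof -
  have wv: "weight_vec (wgt {#}) w" using w by (simp add: maximal_vec_def)
  obtain u where u: "u \<noteq> 0" "weight_vec \<mu> u" using \<mu> by (auto simp: wt_def weight_vec_def)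
  let ?G = "{g \<in> {lower_word l w | l. True}. weight_vec \<mu> g}"
  have "u \<in> v.span ?G"
    by (rule weight_component[OF u(2)]) (use gen lower_word_weight_vec[OF wv] in auto)
  then have "\<not> ?G \<subseteq> {0}" using u(1) v.span_mono[of ?G "{0}"] by auto
  then obtain l where "lower_word l w \<noteq> 0" "weight_vec \<mu> (lower_word l w)" by blast
  then show thesis using that[of l] weight_vec_unique[OF lower_word_weight_vec[OF wv, of l]] by fastforce
qed

text \<open>
  First climb along \<open>J\<close> until only nodes outside \<open>J\<close> are left, then continue by combinatorics alone.
  The end of the climb has independent support outside \<open>J\<close>, so the corresponding word does not
  annihilate the highest weight vector, and the end is a weight.
\<close>
lemma weight_climbs_to_independent:
  assumes w: "maximal_vec (wgt {#}) w" and gen: "v.span {lower_word l w | l. True} = UNIV"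
    and lam: "lam \<in> dual_space sh" and "wgt x \<in> wt sh \<iota> sv act"
  obtains z where "climbs A a (set_mset x) x z" and "wgt z \<in> wt sh \<iota> sv act"
    and "independent_nodes A (set_mset z)" and "\<And>i. i \<in># z \<Longrightarrow> a i < count z i"
proof -
  have wv: "weight_vec (wgt {#}) w" using w by (simp add: maximal_vec_def)
  obtain l where l: "lower_word l w \<noteq> 0" "x = mset l"
    using weight_is_word[OF w gen assms(4)] by (metis below_eq_iff)
  have "0 \<le> lab i {#}" for i by (simp add: label_def)
  then obtain J where
        free: "\<And>l'. set l' \<subseteq> UNIV - J \<Longrightarrow> independent_nodes A (set l') \<Longrightarrow> lower_word l' w \<noteq> 0"
    and first: "climbs A a J x (filter_mset (\<lambda>i. i \<notin> J) x)"
    using free_nodes_and_climb[of UNIV "{#}" w l] w l by auto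
  obtain z where z: "climbs A a (set_mset (filter_mset (\<lambda>i. i \<notin> J) x)) (filter_mset (\<lambda>i. i \<notin> J) x) z"
    "independent_nodes A (set_mset z)" "\<forall>i\<in>#z. a i < count z i"
    using climbs_to_independent[OF gcm] by blast
  obtain lz where lz: "mset lz = z" using ex_mset by blast
  have "set lz \<subseteq> UNIV - J"
    using set_mset_mono[OF climbs_subset[OF z(1)]] by (auto simp: set_mset_mset[symmetric] lz simp del: set_mset_mset)
  then have "lower_word lz w \<noteq> 0" using free z(2) by (simp add: lz[symmetric])
  then have "wgt z \<in> wt sh \<iota> sv act"
    using lower_word_weight_vec[OF wv, of lz] below_dual[OF lam] unfolding wt_def weight_vec_def by (auto simp: lz)
  moreover have "climbs A a UNIV x z"
    by (rule climbs_trans[OF climbs_mono[OF first] climbs_mono[OF z(1)]]) auto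
  then have "climbs A a (set_mset x) x z" using climbs_restrict by fastforce
  ultimately show thesis using that z by blast
qed

end

section \<open>Generators of quotients of Verma modules\<close>

lemma left_ideal_hull: "left_ideal (left_ideal hull S)"
  by (rule hull_in) (auto simp: left_ideal_def)

context
  fixes L :: "'r::ring_1 set"
  assumes L: "left_ideal L"
begin

lemma left_ideal_diff: "x \<in> L \<Longrightarrow> y \<in> L \<Longrightarrow> x - y \<in> L"
proof -
  assume "x \<in> L" "y \<in> L"
  then have "x + (- 1) * y \<in> L" using L unfolding left_ideal_def by blast
  then show ?thesis by simp
qed

lemma lcoset_eqI: "a - b \<in> L \<Longrightarrow> lcoset L a = lcoset L b"
proof -
  have "lcoset L a \<subseteq> lcoset L b" if ab: "a - b \<in> L" for a b
  proof
    fix c assume "c \<in> lcoset L a"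
    then have "(c - a) + (a - b) \<in> L" using L ab unfolding lcoset_def left_ideal_def by blast
    then show "c \<in> lcoset L b" by (simp add: lcoset_def)
  qed
  moreover assume "a - b \<in> L"
  moreover have "0 - (a - b) \<in> L"
    using left_ideal_diff[of 0 "a - b"] L \<open>a - b \<in> L\<close> unfolding left_ideal_def by blast
  ultimately show ?thesis by (metis diff_0 minus_diff_eq subset_antisym)
qed

lemma quot_mult_lcoset: "quot_mult L r (lcoset L a) = lcoset L (r * a)"
proof -
  have "lcoset L (r * b) = lcoset L (r * a)" if "b \<in> lcoset L a" for b
  proof (rule lcoset_eqI)
    have "r * (b - a) \<in> L" using that L by (auto simp: lcoset_def left_ideal_def)
    then show "r * b - r * a \<in> L" by (simp add: right_diff_distrib)
  qed
  moreover have "a \<in> lcoset L a" using L by (simp add: lcoset_def left_ideal_def)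
  ultimately show ?thesis unfolding quot_mult_def by blast
qed

lemma quot_add_lcoset: "quot_add L (lcoset L a) (lcoset L b) = lcoset L (a + b)"
proof -
  have "lcoset L (x + y) = lcoset L (a + b)" if "x \<in> lcoset L a" "y \<in> lcoset L b" for x y
  proof (rule lcoset_eqI)
    have "(x - a) + (y - b) \<in> L" using that L by (auto simp: lcoset_def left_ideal_def)
    then show "x + y - (a + b) \<in> L" by (simp add: algebra_simps)
  qed
  moreover have "a \<in> lcoset L a" "b \<in> lcoset L b" using L by (auto simp: lcoset_def left_ideal_def)
  ultimately show ?thesis unfolding quot_add_def by blast
qed

end

lemma free_alg_induct [case_names one add letter scale]:
  fixes x :: "'a free_alg"
  assumes "P 1" and "\<And>x y. P x \<Longrightarrow> P y \<Longrightarrow> P (x + y)"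
    and "\<And>x a. P x \<Longrightarrow> P (letter a * x)" and "\<And>x c. P x \<Longrightarrow> P (scalar c * x)"
  shows "P x"
proof (induction x rule: Poly_Mapping.update_induct)
  case const
  have "P (scalar 0 * 1)" using assms(1,4) by blast
  then show ?case by (simp add: scalar_def)
next
  case (update p k c)
  have word: "P (Poly_Mapping.single (FWord xs) 1)" for xs
  proof (induction xs)
    case Nil
    show ?case using assms(1) by (simp add: zero_fword_def[symmetric])
  next
    case (Cons a xs)
    from assms(3)[OF this, of a] show ?case by (simp add: letter_def mult_single)
  qed
  have "P (scalar c * Poly_Mapping.single k 1)"
    using assms(4) word by (cases k) simp
  then have "P (p + Poly_Mapping.single k c)"
    using assms(2) update by (simp add: scalar_def mult_single)
  moreover have "Poly_Mapping.update k c p = p + Poly_Mapping.single k c"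
    using update(1) by (intro poly_mapping_eqI) (auto simp: lookup_update lookup_add lookup_single in_keys_iff when_def)
  ultimately show ?case by simp
qed

text \<open>The vector is the image of the canonical generator of the Verma module.\<close>
lemma highest_weight_vector:
  fixes sv :: "complex \<Rightarrow> 'v::ab_group_add \<Rightarrow> 'v"
  assumes "highest_weight_module sg br \<iota> e lam sv act"
  obtains w where "w \<noteq> 0" and "\<And>i. act (e i) w = 0" and "\<And>x. act (\<iota> x) w = sv (lam x) w"
    and "\<And>M. module.subspace sv M \<Longrightarrow> w \<in> M \<Longrightarrow> (\<And>x u. u \<in> M \<Longrightarrow> act x u \<in> M) \<Longrightarrow> M = UNIV"
proof -
  let ?L = "verma_ideal sg br \<iota> e lam"
  obtain \<pi> where
        add: "\<And>X Y. X \<in> verma sg br \<iota> e lam \<Longrightarrow> Y \<in> verma sg br \<iota> e lam \<Longrightarrow>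
          \<pi> (verma_add sg br \<iota> e lam X Y) = \<pi> X + \<pi> Y"
    and scale: "\<And>c X. X \<in> verma sg br \<iota> e lam \<Longrightarrow> \<pi> (verma_scale sg br \<iota> e lam c X) = sv c (\<pi> X)"
    and act: "\<And>x X. X \<in> verma sg br \<iota> e lam \<Longrightarrow> \<pi> (verma_act sg br \<iota> e lam x X) = act x (\<pi> X)"
    and onto: "\<pi> ` verma sg br \<iota> e lam = UNIV"
    using assms unfolding highest_weight_module_def by blast
  obtain v0 where v0: "v0 \<noteq> (0 :: 'v)" using assms unfolding highest_weight_module_def by blast
  interpret lie_module sg br sv act using assms by (simp add: highest_weight_module_def)
  have L: "left_ideal ?L" by (simp add: verma_ideal_def left_ideal_hull)
  define q where "q x = \<pi> (lcoset ?L x)" for x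
  have q_add: "q (x + y) = q x + q y" for x y
    using add[of "lcoset ?L x" "lcoset ?L y"] by (simp add: q_def verma_def verma_add_def quot_add_lcoset[OF L])
  have q_scale: "q (scalar c * x) = sv c (q x)" for c x
    using scale[of "lcoset ?L x" c] by (simp add: q_def verma_def verma_scale_def quot_mult_lcoset[OF L])
  have q_act: "q (letter y * x) = act y (q x)" for y x
    using act[of "lcoset ?L x" y] by (simp add: q_def verma_def verma_act_def quot_mult_lcoset[OF L])
  have q_onto: "\<exists>x. u = q x" for u
    using onto unfolding verma_def q_def by (metis (no_types, lifting) UNIV_I image_iff)
  have "q 0 = 0" using q_add[of 0 0] by simp
  then have q_L: "q x = 0" if "x \<in> ?L" for x
    using that lcoset_eqI[OF L, of x 0] by (simp add: q_def)
  have gen: "M = UNIV" if M: "v.subspace M" "q 1 \<in> M" "\<And>x u. u \<in> M \<Longrightarrow> act x u \<in> M" for M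
  proof -
    have "q x \<in> M" for x
      by (induction x rule: free_alg_induct)
        (auto simp: q_add q_scale q_act M intro: v.subspace_add v.subspace_scale)
    then show ?thesis using q_onto by (metis UNIV_eq_I)
  qed
  show thesis
  proof (rule that[of "q 1"])
    show "q 1 \<noteq> 0"
    proof
      assume "q 1 = 0"
      have "act x 0 = 0" for x
      proof -
        interpret Vector_Spaces.linear sv sv "act x" by (rule act_linear_right)
        show ?thesis by (rule zero)
      qed
      then have "{0} = (UNIV :: 'v set)"
        using \<open>q 1 = 0\<close> by (intro gen) (auto simp: v.subspace_def)
      then show False using v0 by blast
    qed
    show "act (e i) (q 1) = 0" for i
    proof -
      have "letter (e i) \<in> ?L"
        unfolding verma_ideal_def n_plus_def by (rule hull_inc) (blast intro: hull_inc)
      then show ?thesis using q_L q_act[of "e i" 1] by simp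
    qed
    show "act (\<iota> x) (q 1) = sv (lam x) (q 1)" for x
    proof -
      have "letter (\<iota> x) - scalar (lam x) \<in> ?L"
        unfolding verma_ideal_def by (rule hull_inc) blast
      then have "q (letter (\<iota> x) - scalar (lam x)) = 0" by (rule q_L)
      then have "q (letter (\<iota> x) * 1) = q (scalar (lam x) * 1)"
        using q_add[of "letter (\<iota> x) - scalar (lam x)" "scalar (lam x)"] by simp
      then show ?thesis by (simp only: q_act q_scale)
    qed
    show "M = UNIV" if "v.subspace M" "q 1 \<in> M" "\<And>x u. u \<in> M \<Longrightarrow> act x u \<in> M" for M
      using that by (rule gen)
  qed
qed

section \<open>Climbing in a highest weight module\<close>

theorem proposition6p2:
  fixes A :: "int ^ 'i::finite ^ 'i"
    and sh :: "complex \<Rightarrow> 'h::ab_group_add \<Rightarrow> 'h"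
    and coroot :: "'i \<Rightarrow> 'h"
    and sroot :: "'i \<Rightarrow> 'h \<Rightarrow> complex"
    and sg :: "complex \<Rightarrow> 'g::ab_group_add \<Rightarrow> 'g"
    and br :: "'g \<Rightarrow> 'g \<Rightarrow> 'g"
    and \<iota> :: "'h \<Rightarrow> 'g"
    and e f :: "'i \<Rightarrow> 'g"
    and sv :: "complex \<Rightarrow> 'v::ab_group_add \<Rightarrow> 'v"
    and act :: "'g \<Rightarrow> 'v \<Rightarrow> 'v"
    and lam \<mu> :: "'h \<Rightarrow> complex"
  assumes "kac_moody_algebra A sh coroot sroot sg br \<iota> e f"
    and "lam \<in> dominant_integral sh coroot"
    and "highest_weight_module sg br \<iota> e lam sv act"
    and "J_V A coroot sroot lam (wt sh \<iota> sv act) = UNIV"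
    and "\<mu> \<in> wt sh \<iota> sv act"
    and "\<not> independent_nodes A (supp sroot (lam - \<mu>))"
  shows
    "(\<exists>\<mu>h \<in> wt sh \<iota> sv act. \<exists>i \<in> supp sroot (lam - \<mu>).
        \<mu>h (coroot i) \<in> \<real> \<and> Re (\<mu>h (coroot i)) > 0 \<and>
        wt_less sroot \<mu> \<mu>h \<and>
        \<mu> \<in> wt_interval (sroot i) (simple_reflection coroot sroot i \<mu>h) \<mu>h \<and>
        wt_interval (sroot i) (simple_reflection coroot sroot i \<mu>h) \<mu>h \<subseteq> wt sh \<iota> sv act) \<and>
     (\<exists>(n :: nat) (\<mu>s :: nat \<Rightarrow> 'h \<Rightarrow> complex) (nodes :: nat \<Rightarrow> 'i).
        \<mu>s 0 = \<mu> \<and>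
        (\<forall>t\<in>{0..n}. \<mu>s t \<in> wt sh \<iota> sv act) \<and>
        (\<forall>t\<in>{1..n}.
           wt_less sroot (\<mu>s (t - 1)) (\<mu>s t) \<and>
           nodes t \<in> supp sroot (lam - \<mu>) \<and>
           \<mu>s t (coroot (nodes t)) \<in> of_nat ` {1..} \<and>
           \<mu>s (t - 1) \<in> wt_interval (sroot (nodes t))
             (simple_reflection coroot sroot (nodes t) (\<mu>s t)) (\<mu>s t)) \<and>
        independent_nodes A (supp sroot (lam - \<mu>s n)) \<and>
        (\<exists>d :: 'i \<Rightarrow> nat.
           \<mu>s n = lam - root_comb sroot (\<lambda>i. if i \<in> supp sroot (lam - \<mu>s n) then of_nat (d i) else 0) \<and>
           (\<forall>i \<in> supp sroot (lam - \<mu>s n). real (d i) > Re (lam (coroot i)))))"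
proof -
  interpret kac_moody_algebra A sh coroot sroot sg br \<iota> e f by fact
  interpret lie_module sg br sv act using assms(3) by (simp add: highest_weight_module_def)
  have lam: "lam \<in> dual_space sh" and "\<forall>i. \<exists>n. lam (coroot i) = of_nat n"
    using assms(2) by (auto simp: dominant_integral_def Nats_def)
  then obtain a where a: "\<And>i. lam (coroot i) = of_nat (a i)" by metis
  interpret dominant_km_module A sh coroot sroot sg br \<iota> e f sv act lam a
    by unfold_locales (rule a)
  let ?W = "wt sh \<iota> sv act"
  obtain w where w0: "w \<noteq> 0" and ew: "\<And>i. act (e i) w = 0" and hw: "\<And>x. act (\<iota> x) w = sv (lam x) w"
    and minimal: "\<And>M. v.subspace M \<Longrightarrow> w \<in> M \<Longrightarrow> (\<And>x u. u \<in> M \<Longrightarrow> act x u \<in> M) \<Longrightarrow> M = UNIV"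
    using highest_weight_vector[OF assms(3)] by blast
  have w: "maximal_vec (wgt {#}) w" by (simp add: maximal_vec_def weight_vec_def ew hw)
  have "w = lower_word [] w" by simp
  then have "w \<in> v.span {lower_word l w | l. True}" by (intro v.span_base) blast
  then have gen: "v.span {lower_word l w | l. True} = UNIV"
    by (intro minimal word_span_invariant[OF w] v.subspace_span)
  obtain l where \<mu>: "\<mu> = wgt (mset l)" using weight_is_word[OF w gen assms(5)] by blast
  define x where "x = mset l"
  have \<mu>x: "\<mu> = wgt x" by (simp add: \<mu> x_def)
  have "wgt x \<in> ?W" using assms(5) \<mu>x by simp
  from weight_climbs_to_independent[OF w gen lam this] obtain z
    where z: "climbs A a (set_mset x) x z" "wgt z \<in> ?W" "independent_nodes A (set_mset z)"
      "\<And>i. i \<in># z \<Longrightarrow> a i < count z i" by blast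
  obtain n ms nodes where ms: "ms (0::nat) = x" "ms n = z" "\<forall>t\<le>n. climbs A a (set_mset x) (ms t) z"
    and nodes: "\<forall>t. 1 \<le> t \<longrightarrow> t \<le> n \<longrightarrow> nodes t \<in> set_mset x \<and>
      (\<exists>k>0. ms (t - 1) = ms t + replicate_mset k (nodes t) \<and> int k \<le> lab (nodes t) (ms t))"
    using climbs_chain[OF z(1)] by (elim exE conjE)
  have supp_x: "supp sroot (lam - \<mu>) = set_mset x" by (simp add: \<mu>x supp_below)
  have wt_ms: "wgt (ms t) \<in> ?W" if "t \<le> n" for t
    using climbs_weight[OF w gen lam ms(3)[rule_format, OF that] z(2)] .
  have step: "nodes t \<in> supp sroot (lam - \<mu>) \<and> wt_less sroot (wgt (ms (t - 1))) (wgt (ms t)) \<and>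
      wgt (ms t) (coroot (nodes t)) \<in> of_nat ` {1..} \<and>
      wgt (ms (t - 1)) \<in> wt_interval (sroot (nodes t))
        (simple_reflection coroot sroot (nodes t) (wgt (ms t))) (wgt (ms t)) \<and>
      wt_interval (sroot (nodes t))
        (simple_reflection coroot sroot (nodes t) (wgt (ms t))) (wgt (ms t)) \<subseteq> ?W"
    if t: "1 \<le> t" "t \<le> n" for t
  proof -
    let ?i = "nodes t"
    obtain k where k: "0 < k" "ms (t - 1) = ms t + replicate_mset k ?i" "int k \<le> lab ?i (ms t)"
      using nodes[rule_format, OF t] by blast
    define m where "m = nat (lab ?i (ms t))"
    have m: "lab ?i (ms t) = int m" "k \<le> m" using k by (auto simp: m_def)
    have wm: "wgt (ms t) (coroot ?i) = of_nat m" by (simp add: wgt_coroot m(1))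
    have string: "(\<lambda>z. wgt (ms t) z - of_nat j * sroot ?i z) = wgt (ms t + replicate_mset j ?i)" for j
      by (simp add: fun_eq_iff below_def)
    have int_eq: "wt_interval (sroot ?i) (simple_reflection coroot sroot ?i (wgt (ms t))) (wgt (ms t))
        = {wgt (ms t + replicate_mset j ?i) | j. j \<le> m}"
      unfolding wt_interval_reflection[of "wgt (ms t)", OF wm] string ..
    have "wt_less sroot (wgt (ms (t - 1))) (wgt (ms t))"
      unfolding wt_less_def k(2) using k(1) wt_le_below by (auto simp: below_eq_iff)
    moreover have "of_nat m \<in> (of_nat ` {1..} :: complex set)" using m(2) k(1) by auto
    ultimately show ?thesis
      unfolding int_eq wm
      using nodes[rule_format, OF t] supp_x k(2) m weight_string[OF w gen lam wt_ms[OF t(2)]] by auto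
  qed
  have "n \<noteq> 0"
  proof
    assume "n = 0"
    then have "z = x" using ms(1,2) by simp
    then show False using assms(6) z(3) supp_x by simp
  qed
  then have one: "1 \<le> (1::nat)" "1 \<le> n" by auto
  have first: "wgt (ms (1 - 1)) = \<mu>" by (simp add: ms \<mu>x)
  have part1: "\<exists>\<mu>h \<in> ?W. \<exists>i \<in> supp sroot (lam - \<mu>).
        \<mu>h (coroot i) \<in> \<real> \<and> Re (\<mu>h (coroot i)) > 0 \<and>
        wt_less sroot \<mu> \<mu>h \<and>
        \<mu> \<in> wt_interval (sroot i) (simple_reflection coroot sroot i \<mu>h) \<mu>h \<and>
        wt_interval (sroot i) (simple_reflection coroot sroot i \<mu>h) \<mu>h \<subseteq> ?W"
  proof (intro bexI[of _ "wgt (ms 1)"] bexI[of _ "nodes 1"] conjI)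
    have positive: "c \<in> \<real> \<and> 0 < Re c" if "c \<in> of_nat ` {1..}" for c :: complex
      using that by auto
    show "wgt (ms 1) (coroot (nodes 1)) \<in> \<real>" "0 < Re (wgt (ms 1) (coroot (nodes 1)))"
      using step[OF one] positive by auto
  qed (use step[OF one] wt_ms[OF one(2)] in \<open>simp_all only: first\<close>)
  have fin: "supp sroot (lam - wgt (ms n)) = set_mset z" by (simp add: ms(2) supp_below)
  have multiplicities: "(\<lambda>i. if i \<in> set_mset z then of_nat (count z i) else 0)
      = (\<lambda>i. of_nat (count z i) :: complex)"
    by (auto simp: fun_eq_iff not_in_iff)
  have part2: "wgt (ms n) = lam - root_comb sroot
      (\<lambda>i. if i \<in> supp sroot (lam - wgt (ms n)) then of_nat (count z i) else 0)"
    unfolding fin unfolding ms(2) multiplicities by (rule below_eq_root_comb)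
  show ?thesis
  proof (intro conjI part1 exI[of _ n] exI[of _ "\<lambda>t. wgt (ms t)"] exI[of _ nodes] exI[of _ "count z"])
    show "wgt (ms 0) = \<mu>" by (simp add: ms \<mu>x)
    show "\<forall>t\<in>{0..n}. wgt (ms t) \<in> ?W" using wt_ms by simp
    show "\<forall>t\<in>{1..n}. wt_less sroot (wgt (ms (t - 1))) (wgt (ms t)) \<and>
           nodes t \<in> supp sroot (lam - \<mu>) \<and>
           wgt (ms t) (coroot (nodes t)) \<in> of_nat ` {1..} \<and>
           wgt (ms (t - 1)) \<in> wt_interval (sroot (nodes t))
             (simple_reflection coroot sroot (nodes t) (wgt (ms t))) (wgt (ms t))"
      using step by simp
    show "independent_nodes A (supp sroot (lam - wgt (ms n)))" unfolding fin by (rule z(3))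
    show "wgt (ms n) = lam - root_comb sroot
      (\<lambda>i. if i \<in> supp sroot (lam - wgt (ms n)) then of_nat (count z i) else 0)" by (rule part2)
    show "\<forall>i\<in>supp sroot (lam - wgt (ms n)). Re (lam (coroot i)) < real (count z i)"
      unfolding fin using z(4) by (simp add: a)
  qed
qed

end
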